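(* Consider the randomized Riemannian gossip algorithm on $P_+(n)$ described in the context, started from arbitrary initial matrices $W_{1,0},\dots,W_{m,0}\in P_+(n)$. If the positive step sizes $(\gamma_t)_{t\ge 0}$ satisfy $\sum_t\gamma_t^2<\infty$ and $\sum_t\gamma_t=+\infty$, and $\gamma_t\le1/2$ for all $t$, then the covariance matrices $W_{1,t},\dots,W_{m,t}$ at each node converge almost surely, as $t\to\infty$, to a common value.
   Context: $P_+(n)$ is the set of real symmetric positive definite $n\times n$ matrices, endowed with the metric $\langle X_1,X_2\rangle_P=\mathrm{Tr}(X_1P^{-1}X_2P^{-1})$. The algorithm: there are $m$ nodes labeled $1,\dots,m$, node $i$ holding at time $t$ a matrix $W_{i,t}\in P_+(n)$. At each time $t\ge0$ a node $i\in\{1,\dots,m-1\}$ is picked at random, independently over time, with probability $p_i>0$ ($\sum_{i=1}^{m-1}p_i=1$), and nodes $i$ and $i+1$ are updated by $$W_{i,t+1}=W_{i,t}^{1/2}\exp\bigl(\gamma_t\log(W_{i,t}^{-1/2}W_{i+1,t}W_{i,t}^{-1/2})\bigr)W_{i,t}^{1/2},$$ $$W_{i+1,t+1}=W_{i+1,t}^{1/2}\exp\bigl(\gamma_t\log(W_{i+1,t}^{-1/2}W_{i,t}W_{i+1,t}^{-1/2})\bigr)W_{i+1,t}^{1/2},$$ all other nodes keeping their values (both nodes move towards each other along the geodesic of $P_+(n)$ linking them, by a fraction $\gamma_t$ of their distance); $\exp$ and $\log$ are the matrix exponential and the (symmetric) matrix logarithm. *)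

theory Defs
  imports "HOL-Probability.Probability"
begin

definition posdef_matrices :: "(real^'n^'n) set" where
  "posdef_matrices = {A. transpose A = A \<and> (\<forall>x. x \<noteq> 0 \<longrightarrow> x \<bullet> (A *v x) > 0)}"

(* On real^'n^'n the overloaded multiplication is componentwise and exp is unavailable,
   hence powers and the exponential series with respect to the matrix product. *)
definition matrix_power :: "real^'n^'n \<Rightarrow> nat \<Rightarrow> real^'n^'n" where
  "matrix_power A k = ((\<lambda>B. A ** B) ^^ k) (mat 1)"

definition matrix_exp :: "real^'n^'n \<Rightarrow> real^'n^'n" where
  "matrix_exp A = (\<Sum>k. (1 / fact k) *\<^sub>R matrix_power A k)"

(* The next two are the usual principal square root and symmetric logarithm; they are
   meaningful on posdef_matrices, where the described matrix exists and is unique. *)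
definition matrix_sqrt :: "real^'n^'n \<Rightarrow> real^'n^'n" where
  "matrix_sqrt A = (THE R. R \<in> posdef_matrices \<and> R ** R = A)"

definition matrix_log :: "real^'n^'n \<Rightarrow> real^'n^'n" where
  "matrix_log A = (THE S. transpose S = S \<and> matrix_exp S = A)"

(* Point at fraction g of the way from A to B along the geodesic joining them for the metric
   Tr (X P^-1 Y P^-1): A^(1/2) exp (g log (A^(-1/2) B A^(-1/2))) A^(1/2). *)
definition geodesic_point :: "real^'n^'n \<Rightarrow> real^'n^'n \<Rightarrow> real \<Rightarrow> real^'n^'n" where
  "geodesic_point A B g =
     (let R = matrix_sqrt A; R' = matrix_inv R
      in R ** matrix_exp (g *\<^sub>R matrix_log (R' ** B ** R')) ** R)"

(* Both updates use the old values at i and i + 1. *)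
definition gossip_step :: "real \<Rightarrow> nat \<Rightarrow> (nat \<Rightarrow> real^'n^'n) \<Rightarrow> (nat \<Rightarrow> real^'n^'n)" where
  "gossip_step g i W =
     W(i := geodesic_point (W i) (W (i + 1)) g,
       i + 1 := geodesic_point (W (i + 1)) (W i) g)"

(* gossip \<gamma> s W0 t j is the matrix held by node j at time t, when the step sizes are \<gamma>,
   the nodes picked are s 0, s 1, ... and the initial matrices are W0. *)
primrec gossip ::
  "(nat \<Rightarrow> real) \<Rightarrow> (nat \<Rightarrow> nat) \<Rightarrow> (nat \<Rightarrow> real^'n^'n) \<Rightarrow> nat \<Rightarrow> nat \<Rightarrow> real^'n^'n"
where
  "gossip \<gamma> s W0 0 = W0"
| "gossip \<gamma> s W0 (Suc t) = gossip_step (\<gamma> t) (s t) (gossip \<gamma> s W0 t)"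

end

theory Submission
  imports Defs
begin

text \<open>
  The proof uses the Loewner order instead of Riemannian geometry. Two positive definite matrices
  can be written as \<open>A = P ** transpose P\<close> and \<open>B = congr_diag P d\<close> with the same invertible \<open>P\<close>, and
  then the geodesic from \<open>A\<close> to \<open>B\<close> is the curve \<open>congr_diag P (\<lambda>k. d k powr g)\<close>. Everything about
  one averaging step reduces to the scalar identity
  \<open>1 + d - d powr g - d powr (1 - g) = (1 - d powr g) * (1 - d powr (1 - g))\<close>, whose right-hand side is
  at least a constant times \<open>g * (1 - d)\<^sup>2\<close> as long as \<open>d\<close> stays bounded (\<open>geodesic_gap_lower_bound\<close>).

  Consequently the sum of all matrices held by the nodes decreases in the Loewner order, and
  each step loses at least a constant times \<open>\<gamma> t\<close> times the squared disagreement of the two nodes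
  involved (\<open>averaging_loss_lower_bound\<close>). Since inversion maps geodesics to geodesics, the sum of the
  inverses decreases too. So both sums converge on every path, all matrices stay in a fixed
  compact part of the cone (\<open>gossip_bounds\<close>), and the disagreements of the chosen pairs, weighted with the
  step sizes, have a sum bounded by a constant that depends only on the initial matrices
  (\<open>gossip_dissipation_bounded\<close>).

  Probability enters in one place. The node picked at time \<open>t\<close> is independent of the matrices at
  time \<open>t\<close> and equals \<open>i\<close> with probability \<open>p i > 0\<close>. Taking expectations, the weighted
  disagreements of every pair of neighbours, chosen or not, have an almost surely
  finite sum (\<open>AE_summable_of_sampled_bound\<close>). As the step sizes have an infinite sum, there is a
  sequence of times along which all neighbours agree asymptotically, and along which all matrices
  therefore tend to the limit \<open>L\<close> of their mean.

  Convergence at all times follows from the identity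
  \<open>(X - L) X\<^sup>-\<^sup>1 (X - L) = X - 2 L + L X\<^sup>-\<^sup>1 L\<close>. Summed over the nodes, its right-hand side involves only
  the two convergent sums, so the left-hand side has a limit; this limit is zero along the chosen
  times, hence zero, and the left-hand side controls the distance of every node from \<open>L\<close>.
\<close>

section \<open>Spectral theorem and functional calculus\<close>

text \<open>A maximiser of the Rayleigh quotient on the unit sphere of \<open>S\<close> is an eigenvector: perturbing it
  inside \<open>S\<close> must not increase the quotient to first order.\<close>

lemma symmetric_operator_eigenvector:
  fixes f :: "'a::euclidean_space \<Rightarrow> 'a"
  assumes lin: "linear f" and sym: "\<And>x y. x \<bullet> f y = f x \<bullet> y"
    and S: "subspace S" "f ` S \<subseteq> S" "S \<noteq> {0}"
  obtains v l where "v \<in> S" "norm v = 1" "f v = l *\<^sub>R v"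
proof -
  interpret f: linear f by (rule lin)
  let ?K = "S \<inter> sphere 0 1"
  from S obtain u where "u \<in> S" "u \<noteq> 0"
    using subspace_0 by blast
  then have "u /\<^sub>R norm u \<in> ?K"
    using S(1) by (simp add: subspace_mul)
  then have "?K \<noteq> {}" by blast
  moreover have "compact ?K"
    using S(1) by (simp add: closed_Int_compact closed_subspace)
  moreover have "continuous_on ?K (\<lambda>x. x \<bullet> f x)"
    by (intro continuous_intros linear_continuous_on linear_conv_bounded_linear[THEN iffD1] lin)
  ultimately obtain v where v: "v \<in> ?K" "\<And>y. y \<in> ?K \<Longrightarrow> y \<bullet> f y \<le> v \<bullet> f v"
    using continuous_attains_sup by meson
  define l where "l = v \<bullet> f v"
  have le: "y \<bullet> f y \<le> l * (y \<bullet> y)" if "y \<in> S" for y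
  proof (cases "y = 0")
    case False
    have "y /\<^sub>R norm y \<in> ?K"
      using False that S(1) by (simp add: subspace_mul)
    from v(2)[OF this] have "(y \<bullet> f y) / (norm y * norm y) \<le> l"
      by (simp add: f.scale l_def divide_simps)
    then show ?thesis
      using False by (simp add: divide_le_eq power2_norm_eq_inner[symmetric] power2_eq_square)
  qed simp
  define w where "w = f v - l *\<^sub>R v"
  have vS: "v \<in> S" "v \<bullet> v = 1"
    using v(1) by (auto simp: dot_square_norm)
  have wS: "w \<in> S"
    unfolding w_def using vS S by (intro subspace_diff subspace_mul) auto
  \<comment> \<open>The first-order term of the quotient at \<open>v\<close> in the direction \<open>w\<close> is \<open>2 * e * (w \<bullet> w)\<close>, so \<open>w\<close> must vanish.\<close>
  define b where "b = l * (w \<bullet> w) - w \<bullet> f w"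
  have quad: "2 * e * (w \<bullet> w) \<le> e\<^sup>2 * b" for e
  proof -
    have *: "(v + e *\<^sub>R w) \<bullet> f (v + e *\<^sub>R w) \<le> l * ((v + e *\<^sub>R w) \<bullet> (v + e *\<^sub>R w))"
      using vS wS S(1) by (intro le subspace_add subspace_mul) auto
    have "w \<bullet> f v = w \<bullet> w + l * (v \<bullet> w)"
      unfolding w_def by (simp add: algebra_simps inner_commute)
    moreover have "v \<bullet> f w = w \<bullet> f v"
      by (metis sym inner_commute)
    moreover have "v \<bullet> f v = l" by (simp add: l_def)
    ultimately show ?thesis
      using * vS(2) unfolding b_def f.add f.scale
      by (simp add: algebra_simps power2_eq_square inner_commute)
  qed
  have "w = 0"
  proof (rule ccontr)
    assume "w \<noteq> 0"
    then have pos: "w \<bullet> w > 0" by simp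
    let ?e = "(w \<bullet> w) / (\<bar>b\<bar> + 1)"
    have e: "?e > 0" using pos by (intro divide_pos_pos) auto
    have "?e * (2 * (w \<bullet> w)) \<le> ?e * (?e * b)"
      using quad[of ?e] by (simp only: power2_eq_square mult_ac)
    then have "2 * (w \<bullet> w) \<le> ?e * b"
      using e by (simp only: mult_le_cancel_left_pos)
    also have "\<dots> \<le> ?e * (\<bar>b\<bar> + 1)"
      using e by (intro mult_left_mono) auto
    also have "\<dots> = w \<bullet> w" by simp
    finally show False using pos by simp
  qed
  then show ?thesis
    using that[of v l] v(1) by (simp add: w_def)
qed

text \<open>An orthonormal set of eigenvectors of greatest size spans the space, because its orthogonal
  complement is invariant and would otherwise contain a further eigenvector.\<close>

lemma symmetric_operator_eigenbasis:
  fixes f :: "'a::euclidean_space \<Rightarrow> 'a"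
  assumes lin: "linear f" and sym: "\<And>x y. x \<bullet> f y = f x \<bullet> y"
  obtains B where "pairwise orthogonal B" "\<And>b. b \<in> B \<Longrightarrow> norm b = 1"
    "\<And>b. b \<in> B \<Longrightarrow> \<exists>l. f b = l *\<^sub>R b" "finite B" "card B = DIM('a)"
proof -
  interpret f: linear f by (rule lin)
  let ?P = "\<lambda>B. pairwise orthogonal B \<and> (\<forall>b\<in>B. norm b = 1) \<and> (\<forall>b\<in>B. \<exists>l. f b = l *\<^sub>R b)"
  have ind: "independent B" if "?P B" for B
    using that by (intro pairwise_orthogonal_independent) auto
  have "\<exists>B. ?P B \<and> (\<forall>C. ?P C \<longrightarrow> card C \<le> card B)"
  proof (rule ex_has_greatest_nat)
    show "?P {}" by simp
    show "\<forall>B. ?P B \<longrightarrow> card B < Suc DIM('a)"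
      using ind independent_card_le by (metis le_imp_less_Suc)
  qed
  then obtain B where B: "?P B" and max: "\<And>C. ?P C \<Longrightarrow> card C \<le> card B"
    by blast
  have fin: "finite B" using ind[OF B] independent_imp_finite by blast
  let ?S = "{y. \<forall>x\<in>B. orthogonal x y}"
  have "?S = {0}"
  proof (rule ccontr)
    assume ne: "?S \<noteq> {0}"
    have "f y \<in> ?S" if y: "y \<in> ?S" for y
    proof (clarsimp)
      fix x assume "x \<in> B"
      with B obtain l where "f x = l *\<^sub>R x" by blast
      then have "x \<bullet> f y = l * (x \<bullet> y)" by (simp add: sym)
      with y \<open>x \<in> B\<close> show "orthogonal x (f y)" by (simp add: orthogonal_def)
    qed
    then have "f ` ?S \<subseteq> ?S" by blast
    then obtain v l where v: "v \<in> ?S" "norm v = 1" "f v = l *\<^sub>R v"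
      using symmetric_operator_eigenvector[OF lin sym subspace_orthogonal_to_vectors _ ne] by metis
    have "v \<notin> B"
      using v by (auto simp: orthogonal_def)
    have "?P (insert v B)"
      using B v by (auto simp: pairwise_insert orthogonal_commute)
    from max[OF this] \<open>v \<notin> B\<close> fin show False by simp
  qed
  have "span B = UNIV"
  proof (rule ccontr)
    assume "span B \<noteq> UNIV"
    then have "span B \<subset> UNIV" by blast
    then obtain x where "x \<noteq> 0" "\<And>y. y \<in> span B \<Longrightarrow> orthogonal x y"
      using orthogonal_to_subspace_exists_gen[of B UNIV] by auto
    then have "x \<in> ?S" by (auto simp: span_base orthogonal_commute)
    with \<open>?S = {0}\<close> \<open>x \<noteq> 0\<close> show False by blast
  qed
  then have "card B = DIM('a)"
    using ind[OF B] by (metis dim_UNIV dim_eq_card_independent dim_span)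
  with that[of B] B fin show thesis by blast
qed

definition diag_matrix :: "('n \<Rightarrow> real) \<Rightarrow> real^'n^'n" where
  "diag_matrix d = (\<chi> i j. if i = j then d i else 0)"

text \<open>The symmetric matrix whose quadratic form becomes diagonal in the coordinates given by the columns
  of \<open>P\<close>. Allowing \<open>P\<close> to be merely invertible, and not only orthogonal, lets two positive definite
  matrices share the same \<open>P\<close>; with \<open>P\<close> orthogonal, it is an eigendecomposition.\<close>

definition congr_diag :: "real^'n^'n \<Rightarrow> ('n \<Rightarrow> real) \<Rightarrow> real^'n^'n" where
  "congr_diag P d = P ** diag_matrix d ** transpose P"

lemma matrix_mult_diag_nth: "(A ** diag_matrix d) $ i $ j = A $ i $ j * d j"
  unfolding matrix_matrix_mult_def diag_matrix_def by (simp add: if_distrib cong: if_cong)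

lemma diag_matrix_mult_nth: "(diag_matrix d ** A) $ i $ j = d i * A $ i $ j"
  unfolding matrix_matrix_mult_def diag_matrix_def
  by (simp add: if_distribR if_distrib cong: if_cong)

lemma diag_matrix_mult: "diag_matrix d ** diag_matrix e = diag_matrix (\<lambda>k. d k * e k)"
  by (simp add: vec_eq_iff matrix_mult_diag_nth) (simp add: diag_matrix_def)

lemma diag_matrix_one: "diag_matrix (\<lambda>k. 1) = mat 1"
  by (simp add: diag_matrix_def mat_def)

lemma transpose_diag_matrix [simp]: "transpose (diag_matrix d) = diag_matrix d"
  by (auto simp: diag_matrix_def transpose_def vec_eq_iff)

lemma transpose_congr_diag [simp]: "transpose (congr_diag P d) = congr_diag P d"
  by (simp add: congr_diag_def matrix_transpose_mul matrix_mul_assoc)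

lemma congr_diag_one: "congr_diag P (\<lambda>k. 1) = P ** transpose P"
  by (simp add: congr_diag_def diag_matrix_one)

lemma congr_diag_nth: "congr_diag P d $ i $ j = (\<Sum>k\<in>UNIV. P $ i $ k * d k * P $ j $ k)"
  unfolding congr_diag_def
  by (subst matrix_matrix_mult_def) (simp add: matrix_mult_diag_nth transpose_def)

lemma congr_diag_add: "congr_diag P d + congr_diag P e = congr_diag P (\<lambda>k. d k + e k)"
  by (simp add: vec_eq_iff congr_diag_nth algebra_simps sum.distrib)

lemma congr_diag_diff: "congr_diag P d - congr_diag P e = congr_diag P (\<lambda>k. d k - e k)"
  by (simp add: vec_eq_iff congr_diag_nth algebra_simps sum_subtractf)

lemma congr_diag_scaleR: "g *\<^sub>R congr_diag P d = congr_diag P (\<lambda>k. g * d k)"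
  by (simp add: vec_eq_iff congr_diag_nth sum_distrib_left algebra_simps)

lemma congr_diag_congr: "Q ** congr_diag P d ** transpose Q = congr_diag (Q ** P) d"
  by (simp add: congr_diag_def matrix_transpose_mul matrix_mul_assoc)

lemma congr_diag_diag: "congr_diag (P ** diag_matrix c) d = congr_diag P (\<lambda>k. c k * d k * c k)"
  by (simp add: vec_eq_iff congr_diag_nth matrix_mult_diag_nth mult_ac)

lemma inner_congr_diag: "x \<bullet> (congr_diag P d *v y) = (\<Sum>k\<in>UNIV. d k * (x v* P) $ k * (y v* P) $ k)"
proof -
  have "x \<bullet> (congr_diag P d *v y) = (x v* P) \<bullet> (diag_matrix d *v (y v* P))"
    unfolding congr_diag_def dot_lmul_matrix
    by (simp add: matrix_vector_mul_assoc[symmetric])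
  moreover have "(diag_matrix d *v z) $ k = d k * z $ k" for z k
    unfolding matrix_vector_mult_def diag_matrix_def
    by (simp add: if_distrib if_distribR cong: if_cong)
  ultimately show ?thesis
    by (simp add: inner_vec_def mult_ac)
qed

lemma orthogonal_matrix_iff: "orthogonal_matrix (U::real^'n^'n) \<longleftrightarrow> U ** transpose U = mat 1"
  unfolding orthogonal_matrix using matrix_left_right_inverse by blast

lemma congr_diag_mult:
  fixes U :: "real^'n^'n"
  assumes "orthogonal_matrix U"
  shows "congr_diag U d ** congr_diag U e = congr_diag U (\<lambda>k. d k * e k)"
proof -
  have "congr_diag U d ** congr_diag U e
        = U ** diag_matrix d ** (transpose U ** U) ** diag_matrix e ** transpose U"
    by (simp add: congr_diag_def matrix_mul_assoc)
  also have "\<dots> = U ** (diag_matrix d ** diag_matrix e) ** transpose U"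
    using assms by (simp add: orthogonal_matrix matrix_mul_assoc[symmetric])
  finally show ?thesis by (simp add: congr_diag_def diag_matrix_mult)
qed

lemma spectral_theorem:
  fixes A :: "real^'n^'n"
  assumes "transpose A = A"
  obtains U d where "orthogonal_matrix U" "A = congr_diag U d"
proof -
  have sym: "x \<bullet> (A *v y) = (A *v x) \<bullet> y" for x y
    using assms by (metis dot_lmul_matrix transpose_matrix_vector)
  obtain B where B: "pairwise orthogonal B" "\<And>b. b \<in> B \<Longrightarrow> norm b = 1"
    "\<And>b. b \<in> B \<Longrightarrow> \<exists>l. A *v b = l *\<^sub>R b" "finite B" "card B = DIM(real^'n)"
    using symmetric_operator_eigenbasis[of "(*v) A"] sym by auto
  have "card B = CARD('n)" using B by simp
  then obtain h where h: "bij_betw h (UNIV::'n set) B"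
    using finite_same_card_bij[of "UNIV::'n set" B] B(4) by auto
  obtain l where l: "\<And>b. b \<in> B \<Longrightarrow> A *v b = l b *\<^sub>R b"
    using B(3) by metis
  define U :: "real^'n^'n" where "U = (\<chi> i j. h j $ i)"
  have hB: "h j \<in> B" for j using h by (auto simp: bij_betw_def)
  have col: "column j U = h j" for j
    by (simp add: column_def U_def vec_eq_iff)
  have orth_h: "orthogonal (h i) (h j)" if "i \<noteq> j" for i j
    using B(1) hB h that by (metis bij_betw_imp_inj_on injD pairwiseD)
  have orth: "orthogonal_matrix U"
    unfolding orthogonal_matrix_orthonormal_columns col
    using B(2)[OF hB] orth_h by blast
  have "A ** U = U ** diag_matrix (l \<circ> h)"
  proof -
    have "(A ** U) $ i $ j = (A *v h j) $ i" for i j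
      by (simp add: matrix_matrix_mult_def matrix_vector_mult_def U_def)
    then show ?thesis
      by (simp add: vec_eq_iff matrix_mult_diag_nth l[OF hB]) (simp add: U_def)
  qed
  then have "A = congr_diag U (l \<circ> h)"
    unfolding congr_diag_def using orth
    by (metis matrix_mul_assoc matrix_mul_rid orthogonal_matrix_iff)
  with orth that show thesis by blast
qed

text \<open>The square root and the logarithm are defined by inverting a matrix function, so they are well
  defined only if a matrix function given by an injective scalar function is injective. The
  matrix \<open>Q\<close> that changes one eigenbasis into the other intertwines the two diagonal matrices, which
  means that \<open>Q $ i $ j\<close> vanishes unless the \<open>j\<close>-th and \<open>i\<close>-th diagonal entries agree; this condition
  is the same before and after applying \<open>f\<close>.\<close>

lemma functional_calculus_unique:
  fixes U V :: "real^'n^'n" and f :: "real \<Rightarrow> real"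
  assumes U: "orthogonal_matrix U" and V: "orthogonal_matrix V"
    and inj: "inj_on f (range d \<union> range e)"
    and eq: "congr_diag U (\<lambda>k. f (d k)) = congr_diag V (\<lambda>k. f (e k))"
  shows "congr_diag U d = congr_diag V e"
proof -
  let ?Q = "transpose V ** U"
  have intertwine: "congr_diag U a = congr_diag V b \<longleftrightarrow> ?Q ** diag_matrix a = diag_matrix b ** ?Q" for a b
  proof
    assume "congr_diag U a = congr_diag V b"
    then have "transpose V ** (congr_diag U a ** U) = (transpose V ** congr_diag V b) ** U"
      by (simp add: matrix_mul_assoc)
    moreover have "congr_diag U a ** U = U ** diag_matrix a"
      using U by (simp add: congr_diag_def orthogonal_matrix matrix_mul_assoc[symmetric])
    moreover have "transpose V ** congr_diag V b = diag_matrix b ** transpose V"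
      using V by (simp add: congr_diag_def orthogonal_matrix matrix_mul_assoc)
    ultimately show "?Q ** diag_matrix a = diag_matrix b ** ?Q"
      by (simp add: matrix_mul_assoc)
  next
    assume "?Q ** diag_matrix a = diag_matrix b ** ?Q"
    then have "V ** (?Q ** diag_matrix a) ** transpose U = V ** (diag_matrix b ** ?Q) ** transpose U"
      by simp
    then have "(V ** transpose V) ** U ** diag_matrix a ** transpose U
      = V ** diag_matrix b ** transpose V ** (U ** transpose U)"
      by (simp add: matrix_mul_assoc)
    then show "congr_diag U a = congr_diag V b"
      using U V by (simp add: orthogonal_matrix_iff congr_diag_def)
  qed
  from eq have *: "?Q $ i $ j * f (d j) = f (e i) * ?Q $ i $ j" for i j
    unfolding intertwine by (metis matrix_mult_diag_nth diag_matrix_mult_nth)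
  have "?Q $ i $ j * d j = e i * ?Q $ i $ j" for i j
  proof (cases "?Q $ i $ j = 0")
    case False
    with *[of i j] have "f (d j) = f (e i)" by (simp add: mult.commute)
    then have "d j = e i" by (rule inj_onD[OF inj]) auto
    then show ?thesis by simp
  qed simp
  then show ?thesis
    unfolding intertwine by (simp add: vec_eq_iff matrix_mult_diag_nth diag_matrix_mult_nth)
qed

section \<open>Matrix functions and geodesics\<close>

lemma matrix_power_congr_diag:
  fixes U :: "real^'n^'n"
  assumes "orthogonal_matrix U"
  shows "matrix_power (congr_diag U d) k = congr_diag U (\<lambda>i. d i ^ k)"
proof (induction k)
  case 0
  show ?case using assms by (simp add: matrix_power_def congr_diag_one orthogonal_matrix_iff)
next
  case (Suc k)
  have "matrix_power (congr_diag U d) (Suc k) = congr_diag U d ** matrix_power (congr_diag U d) k"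
    by (simp add: matrix_power_def)
  with Suc show ?case using assms by (simp add: congr_diag_mult)
qed

text \<open>Powers act on the diagonal factor alone, so the exponential series can be summed in each entry.\<close>

lemma matrix_exp_congr_diag:
  fixes U :: "real^'n^'n"
  assumes "orthogonal_matrix U"
  shows "matrix_exp (congr_diag U d) = congr_diag U (\<lambda>i. exp (d i))"
proof -
  have "(\<lambda>k. ((1 / fact k) *\<^sub>R matrix_power (congr_diag U d) k) $ i $ j)
          sums congr_diag U (\<lambda>i. exp (d i)) $ i $ j" for i j
  proof -
    have "(\<lambda>k. \<Sum>l\<in>UNIV. U $ i $ l * (d l ^ k /\<^sub>R fact k) * U $ j $ l)
            sums (\<Sum>l\<in>UNIV. U $ i $ l * exp (d l) * U $ j $ l)"
      by (intro sums_sum sums_mult sums_mult2 exp_converges)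
    then show ?thesis
      using assms by (simp add: matrix_power_congr_diag congr_diag_scaleR congr_diag_nth field_simps)
  qed
  then have "(\<lambda>k. (1 / fact k) *\<^sub>R matrix_power (congr_diag U d) k) sums congr_diag U (\<lambda>i. exp (d i))"
    unfolding sums_def by (intro vec_tendstoI) simp
  then show ?thesis
    unfolding matrix_exp_def by (simp add: sums_iff)
qed

lemma matrix_inv_mult:
  fixes A :: "real^'n^'n"
  assumes "invertible A"
  shows "A ** matrix_inv A = mat 1" "matrix_inv A ** A = mat 1"
proof -
  have "A ** matrix_inv A = mat 1 \<and> matrix_inv A ** A = mat 1"
    using assms unfolding invertible_def matrix_inv_def by (rule someI_ex)
  then show "A ** matrix_inv A = mat 1" "matrix_inv A ** A = mat 1" by auto
qed

lemma matrix_inv_eqI: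
  fixes A B :: "real^'n^'n"
  assumes "A ** B = mat 1"
  shows "matrix_inv A = B"
proof -
  have "invertible A" using assms invertible_right_inverse by blast
  then have "matrix_inv A ** (A ** B) = B"
    by (simp add: matrix_mul_assoc matrix_inv_mult)
  then show ?thesis using assms by simp
qed

lemma invertibleI_right:
  fixes A B :: "real^'n^'n"
  shows "A ** B = mat 1 \<Longrightarrow> invertible A"
  using invertible_right_inverse by blast

lemma invertible_orthogonal_matrix: "orthogonal_matrix (U::real^'n^'n) \<Longrightarrow> invertible U"
  using invertibleI_right orthogonal_matrix_iff by blast

lemma dual_vector_exists:
  fixes P :: "real^'n^'n"
  assumes "invertible P"
  obtains x where "x v* P = y"
  using that[of "y v* matrix_inv P"] matrix_inv_mult(2)[OF assms]
  by (simp add: vector_matrix_mul_assoc)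

lemma quadratic_congr_diag: "x \<bullet> (congr_diag P d *v x) = (\<Sum>k\<in>UNIV. d k * ((x v* P) $ k)\<^sup>2)"
  by (simp add: inner_congr_diag power2_eq_square mult_ac)

lemma congr_diag_posdef:
  fixes P :: "real^'n^'n"
  assumes "invertible P" "\<And>k. d k > 0"
  shows "congr_diag P d \<in> posdef_matrices"
  unfolding posdef_matrices_def
proof (intro CollectI conjI allI impI transpose_congr_diag)
  fix x :: "real^'n" assume "x \<noteq> 0"
  have "x v* P \<noteq> 0"
  proof
    assume "x v* P = 0"
    then have "x v* (P ** matrix_inv P) = 0"
      by (metis vector_matrix_mul_assoc vector_matrix_mult_0)
    with assms(1) \<open>x \<noteq> 0\<close> show False by (simp add: matrix_inv_mult)
  qed
  then obtain k where "(x v* P) $ k \<noteq> 0" by (auto simp: vec_eq_iff)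
  then show "x \<bullet> (congr_diag P d *v x) > 0"
    unfolding quadratic_congr_diag using assms(2)
    by (intro sum_pos2[where i=k]) (auto simp: less_imp_le)
qed

lemma congr_diag_posdefD:
  fixes P :: "real^'n^'n"
  assumes "congr_diag P d \<in> posdef_matrices" "invertible P"
  shows "d k > 0"
proof -
  obtain x where x: "x v* P = axis k 1" using dual_vector_exists[OF assms(2)] .
  then have "x \<noteq> 0" by auto
  with assms(1) have "x \<bullet> (congr_diag P d *v x) > 0" by (auto simp: posdef_matrices_def)
  then show ?thesis
    unfolding quadratic_congr_diag x
    by (simp add: axis_def if_distrib[where f="\<lambda>x. x\<^sup>2"] if_distrib[where f="(*) _"] cong: if_cong)
qed

text \<open>Every symmetric matrix function of a positive definite matrix is computed from this decomposition.\<close>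

lemma posdef_spectral:
  assumes "A \<in> posdef_matrices"
  obtains U d where "orthogonal_matrix U" "\<And>k. d k > 0" "A = congr_diag U d"
proof -
  from assms have "transpose A = A" by (simp add: posdef_matrices_def)
  then obtain U d where "orthogonal_matrix U" "A = congr_diag U d" by (rule spectral_theorem)
  with that[of U d] show thesis
    using assms congr_diag_posdefD[of U d, OF _ invertible_orthogonal_matrix] by blast
qed

lemma matrix_sqrt_congr_diag:
  assumes U: "orthogonal_matrix U" and d: "\<And>k. d k > 0"
  shows "matrix_sqrt (congr_diag U d) = congr_diag U (\<lambda>k. sqrt (d k))"
  unfolding matrix_sqrt_def
proof (rule the_equality)
  show "congr_diag U (\<lambda>k. sqrt (d k)) \<in> posdef_matrices \<and>
    congr_diag U (\<lambda>k. sqrt (d k)) ** congr_diag U (\<lambda>k. sqrt (d k)) = congr_diag U d"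
    using assms less_imp_le[OF d]
    by (auto simp: congr_diag_mult intro!: congr_diag_posdef invertible_orthogonal_matrix)
next
  fix R assume R: "R \<in> posdef_matrices \<and> R ** R = congr_diag U d"
  then obtain V e where V: "orthogonal_matrix V" "\<And>k. e k > 0" "R = congr_diag V e"
    using posdef_spectral by blast
  have "congr_diag V (\<lambda>k. (e k)\<^sup>2) = congr_diag U (\<lambda>k. (sqrt (d k))\<^sup>2)"
    using R V(1) less_imp_le[OF d] unfolding V(3)
    by (simp add: congr_diag_mult power2_eq_square[symmetric])
  moreover have "inj_on (\<lambda>x. x\<^sup>2) (range e \<union> range (\<lambda>k. sqrt (d k)))"
    using d V(2) by (intro inj_onI) (auto intro!: power2_eq_imp_eq simp: less_imp_le)
  ultimately show "R = congr_diag U (\<lambda>k. sqrt (d k))"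
    using functional_calculus_unique[OF V(1) U] V(3) by blast
qed

lemma matrix_sqrt:
  assumes "A \<in> posdef_matrices"
  shows "matrix_sqrt A \<in> posdef_matrices" "matrix_sqrt A ** matrix_sqrt A = A"
proof -
  obtain U d where A: "orthogonal_matrix U" "\<And>k. d k > 0" "A = congr_diag U d"
    using posdef_spectral[OF assms] by blast
  show "matrix_sqrt A \<in> posdef_matrices" "matrix_sqrt A ** matrix_sqrt A = A"
    using A(1,2) less_imp_le[OF A(2)] unfolding A(3)
    by (auto simp: matrix_sqrt_congr_diag congr_diag_mult intro!: congr_diag_posdef invertible_orthogonal_matrix)
qed

lemma matrix_log_congr_diag:
  assumes U: "orthogonal_matrix U" and d: "\<And>k. d k > 0"
  shows "matrix_log (congr_diag U d) = congr_diag U (\<lambda>k. ln (d k))"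
  unfolding matrix_log_def
proof (rule the_equality)
  show "transpose (congr_diag U (\<lambda>k. ln (d k))) = congr_diag U (\<lambda>k. ln (d k)) \<and>
    matrix_exp (congr_diag U (\<lambda>k. ln (d k))) = congr_diag U d"
    using assms by (simp add: matrix_exp_congr_diag)
next
  fix S assume S: "transpose S = S \<and> matrix_exp S = congr_diag U d"
  then obtain V e where V: "orthogonal_matrix V" "S = congr_diag V e"
    using spectral_theorem by blast
  have "congr_diag V (\<lambda>k. exp (e k)) = congr_diag U (\<lambda>k. exp (ln (d k)))"
    using S V d by (simp add: matrix_exp_congr_diag)
  moreover have "inj_on exp (range e \<union> range (\<lambda>k. ln (d k)))"
    by (intro inj_onI) simp
  ultimately show "S = congr_diag U (\<lambda>k. ln (d k))"
    using functional_calculus_unique[OF V(1) U] V(2) by blast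
qed

lemma posdef_invertible:
  assumes "A \<in> posdef_matrices"
  shows "invertible A"
proof -
  obtain U d where A: "orthogonal_matrix U" "\<And>k. d k > 0" "A = congr_diag U d"
    using posdef_spectral[OF assms] by blast
  have "A ** congr_diag U (\<lambda>k. 1 / d k) = mat 1"
    using A(1) less_imp_neq[OF A(2)] unfolding A(3)
    by (simp add: congr_diag_mult congr_diag_one orthogonal_matrix_iff)
  then show ?thesis by (rule invertibleI_right)
qed

lemma transpose_matrix_inv:
  fixes A :: "real^'n^'n"
  assumes "invertible A"
  shows "transpose (matrix_inv A) = matrix_inv (transpose A)"
proof -
  have "transpose A ** transpose (matrix_inv A) = mat 1"
    using assms by (simp flip: matrix_transpose_mul add: matrix_inv_mult)
  then show ?thesis by (simp add: matrix_inv_eqI)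
qed

text \<open>In coordinates in which the first end point is the identity and the second is \<open>diag_matrix d\<close>,
  the geodesic is the curve of powers of \<open>d\<close>. The reason is that \<open>V = A^(-1/2) P\<close> is orthogonal when
  \<open>A = P ** transpose P\<close>, so that \<open>A^(-1/2) B A^(-1/2)\<close> has \<open>V\<close> as eigenbasis and \<open>d\<close> as spectrum.\<close>

lemma geodesic_point_congr_diag:
  fixes P :: "real^'n^'n"
  assumes P: "invertible P" and d: "\<And>k. d k > 0"
  shows "geodesic_point (P ** transpose P) (congr_diag P d) g = congr_diag P (\<lambda>k. d k powr g)"
proof -
  let ?A = "P ** transpose P"
  define R where "R = matrix_sqrt ?A"
  define R' where "R' = matrix_inv R"
  have "?A \<in> posdef_matrices"
    using congr_diag_posdef[OF P, of "\<lambda>_. 1"] by (simp add: congr_diag_one)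
  then have R: "R \<in> posdef_matrices" "R ** R = ?A"
    unfolding R_def by (rule matrix_sqrt)+
  have tR: "transpose R = R" using R(1) by (simp add: posdef_matrices_def)
  have inv: "R ** R' = mat 1" "R' ** R = mat 1"
    unfolding R'_def using posdef_invertible[OF R(1)] by (simp_all add: matrix_inv_mult)
  have tR': "transpose R' = R'"
    unfolding R'_def using posdef_invertible[OF R(1)] tR by (simp add: transpose_matrix_inv)
  define V where "V = R' ** P"
  have "V ** transpose V = R' ** ?A ** R'"
    unfolding V_def matrix_transpose_mul tR' by (simp add: matrix_mul_assoc)
  also have "\<dots> = (R' ** R) ** (R ** R')"
    unfolding R(2)[symmetric] by (simp add: matrix_mul_assoc)
  finally have V: "orthogonal_matrix V"
    using inv by (simp add: orthogonal_matrix_iff)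
  have RV: "R ** V = P" unfolding V_def by (simp add: matrix_mul_assoc inv)
  have C: "R' ** congr_diag P d ** R' = congr_diag V d"
    unfolding V_def using congr_diag_congr[of R' P d] by (simp add: tR')
  have "geodesic_point ?A (congr_diag P d) g = R ** matrix_exp (g *\<^sub>R matrix_log (congr_diag V d)) ** R"
    unfolding geodesic_point_def Let_def R_def[symmetric] R'_def[symmetric] C ..
  also have "\<dots> = R ** congr_diag V (\<lambda>k. d k powr g) ** R"
    using V d less_imp_neq[OF d] by (simp add: matrix_log_congr_diag congr_diag_scaleR matrix_exp_congr_diag powr_def)
  also have "\<dots> = congr_diag P (\<lambda>k. d k powr g)"
    using congr_diag_congr[of R V "\<lambda>k. d k powr g"] by (simp add: tR RV)
  finally show ?thesis .
qed

text \<open>Both nodes travel on the same geodesic: scaling the columns of \<open>P\<close> by \<open>sqrt d\<close> makes the other end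
  point the identity, and the reversed geodesic is again a curve of powers in the same coordinates.\<close>

lemma geodesic_point_congr_diag_rev:
  fixes P :: "real^'n^'n"
  assumes P: "invertible P" and d: "\<And>k. d k > 0"
  shows "geodesic_point (congr_diag P d) (P ** transpose P) g = congr_diag P (\<lambda>k. d k powr (1 - g))"
proof -
  define Q where "Q = P ** diag_matrix (\<lambda>k. sqrt (d k))"
  have dn: "d k \<noteq> 0" "d k \<ge> 0" for k using d[of k] by simp_all
  have "diag_matrix (\<lambda>k. sqrt (d k)) ** diag_matrix (\<lambda>k. 1 / sqrt (d k)) = mat 1"
    using dn by (simp add: diag_matrix_mult diag_matrix_one)
  then have Q: "invertible Q"
    unfolding Q_def using P invertible_mult invertibleI_right by blast
  have QQ: "Q ** transpose Q = congr_diag P d"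
    unfolding congr_diag_one[symmetric] Q_def congr_diag_diag using dn by simp
  have "congr_diag Q (\<lambda>k. 1 / d k) = congr_diag P (\<lambda>k. 1)"
    unfolding Q_def congr_diag_diag using dn by simp
  then have "geodesic_point (congr_diag P d) (P ** transpose P) g = congr_diag Q (\<lambda>k. (1 / d k) powr g)"
    using geodesic_point_congr_diag[OF Q, of "\<lambda>k. 1 / d k" g] d by (simp add: QQ congr_diag_one)
  also have "\<dots> = congr_diag P (\<lambda>k. d k powr (1 - g))"
    unfolding Q_def congr_diag_diag using dn by (simp add: powr_diff powr_divide)
  finally show ?thesis .
qed

text \<open>First a congruence by \<open>A^(-1/2)\<close> turns \<open>A\<close> into the identity, then a rotation diagonalizes the
  image of \<open>B\<close> without changing the identity.\<close>

lemma simultaneous_diagonalization: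
  fixes A B :: "real^'n^'n"
  assumes A: "A \<in> posdef_matrices" and B: "B \<in> posdef_matrices"
  obtains P d where "invertible P" "\<And>k. d k > 0" "A = P ** transpose P" "B = congr_diag P d"
proof -
  define R where "R = matrix_sqrt A"
  define R' where "R' = matrix_inv R"
  have R: "R \<in> posdef_matrices" "R ** R = A"
    unfolding R_def using A by (rule matrix_sqrt)+
  have tR: "transpose R = R" using R(1) by (simp add: posdef_matrices_def)
  have tB: "transpose B = B" using B by (simp add: posdef_matrices_def)
  have iR: "invertible R" using posdef_invertible[OF R(1)] .
  have inv: "R ** R' = mat 1" "R' ** R = mat 1"
    unfolding R'_def using iR by (simp_all add: matrix_inv_mult)
  have tR': "transpose R' = R'"
    unfolding R'_def using iR tR by (simp add: transpose_matrix_inv)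
  have "transpose (R' ** B ** R') = R' ** B ** R'"
    by (simp add: matrix_transpose_mul tR' tB matrix_mul_assoc)
  then obtain V d where V: "orthogonal_matrix V" "R' ** B ** R' = congr_diag V d"
    by (rule spectral_theorem)
  define P where "P = R ** V"
  have P: "invertible P"
    unfolding P_def using iR V(1) invertible_mult invertible_orthogonal_matrix by blast
  have "P ** transpose P = R ** (V ** transpose V) ** R"
    by (simp add: P_def matrix_transpose_mul tR matrix_mul_assoc)
  then have 1: "A = P ** transpose P"
    using V(1) R(2) by (simp add: orthogonal_matrix_iff)
  have "congr_diag P d = (R ** R') ** B ** (R' ** R)"
    using congr_diag_congr[of R V d, symmetric] by (simp add: P_def tR V(2)[symmetric] matrix_mul_assoc)
  then have 2: "B = congr_diag P d" by (simp add: inv)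
  show thesis
    using that[OF P _ 1 2] congr_diag_posdefD[OF _ P] B 2 by blast
qed

lemma matrix_inv_congr_diag:
  fixes P :: "real^'n^'n"
  assumes P: "invertible P" and d: "\<And>k. d k > 0"
  shows "matrix_inv (congr_diag P d) = congr_diag (transpose (matrix_inv P)) (\<lambda>k. 1 / d k)"
proof (rule matrix_inv_eqI)
  have dn: "d k \<noteq> 0" for k using d[of k] by simp
  have "transpose P ** transpose (matrix_inv P) = mat 1"
    using P by (simp flip: matrix_transpose_mul add: matrix_inv_mult)
  then have "congr_diag P d ** congr_diag (transpose (matrix_inv P)) (\<lambda>k. 1 / d k)
     = P ** (diag_matrix d ** diag_matrix (\<lambda>k. 1 / d k)) ** matrix_inv P"
    unfolding congr_diag_def transpose_transpose
    by (simp add: matrix_mul_assoc) (simp add: matrix_mul_assoc[symmetric])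
  then show "congr_diag P d ** congr_diag (transpose (matrix_inv P)) (\<lambda>k. 1 / d k) = mat 1"
    using P dn by (simp add: diag_matrix_mult diag_matrix_one matrix_inv_mult)
qed

lemma posdef_matrix_inv:
  assumes "A \<in> posdef_matrices"
  shows "matrix_inv A \<in> posdef_matrices"
proof -
  obtain U d where A: "orthogonal_matrix U" "\<And>k. d k > 0" "A = congr_diag U d"
    using posdef_spectral[OF assms] by blast
  have "invertible (transpose (matrix_inv U))"
    using invertible_orthogonal_matrix[OF A(1)] matrix_inv_mult(2) invertibleI_right transpose_invertible by blast
  then show ?thesis
    unfolding A(3) matrix_inv_congr_diag[OF invertible_orthogonal_matrix[OF A(1)] A(2)]
    using A(2) by (intro congr_diag_posdef) auto
qed

lemma geodesic_point_posdef:
  assumes "A \<in> posdef_matrices" "B \<in> posdef_matrices"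
  shows "geodesic_point A B g \<in> posdef_matrices"
proof -
  obtain P d where P: "invertible P" "\<And>k. d k > 0" "A = P ** transpose P" "B = congr_diag P d"
    using simultaneous_diagonalization[OF assms] by blast
  show ?thesis unfolding P(3,4) geodesic_point_congr_diag[OF P(1,2)]
    using P(1) less_imp_neq[OF P(2)] by (intro congr_diag_posdef) (auto simp: powr_gt_zero)
qed

text \<open>Inversion is an isometry of the metric. Hence inverting all matrices of a run of the algorithm
  gives another run, and every upper bound on the matrices has a counterpart for their inverses.\<close>

lemma geodesic_point_matrix_inv:
  assumes "A \<in> posdef_matrices" "B \<in> posdef_matrices"
  shows "geodesic_point (matrix_inv A) (matrix_inv B) g = matrix_inv (geodesic_point A B g)"
proof -
  obtain P d where P: "invertible P" "\<And>k. d k > 0" "A = P ** transpose P" "B = congr_diag P d"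
    using simultaneous_diagonalization[OF assms] by blast
  let ?Q = "transpose (matrix_inv P)"
  have Q: "invertible ?Q"
    using P(1) matrix_inv_mult(2) invertibleI_right transpose_invertible by blast
  have iA: "matrix_inv A = ?Q ** transpose ?Q"
    using matrix_inv_congr_diag[OF P(1), of "\<lambda>_. 1"] by (simp add: P(3) congr_diag_one)
  have "geodesic_point (matrix_inv A) (matrix_inv B) g = congr_diag ?Q (\<lambda>k. (1 / d k) powr g)"
    unfolding iA unfolding P(4) matrix_inv_congr_diag[OF P(1,2)]
    using geodesic_point_congr_diag[OF Q, of "\<lambda>k. 1 / d k"] P(2) by simp
  also have "\<dots> = congr_diag ?Q (\<lambda>k. 1 / (d k powr g))"
    using P(2) by (simp add: powr_divide less_imp_le)
  also have "\<dots> = matrix_inv (geodesic_point A B g)"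
    unfolding P(3,4) geodesic_point_congr_diag[OF P(1,2)]
    using P(2) less_imp_neq[OF P(2)] by (subst matrix_inv_congr_diag[OF P(1)]) (auto simp: powr_gt_zero)
  finally show ?thesis .
qed

section \<open>Energy lost in one averaging step\<close>

text \<open>Convexity of the exponential function; this is the weighted arithmetic-geometric mean inequality of
  \<open>1\<close> and \<open>d\<close>.\<close>

lemma powr_le_affine:
  fixes d a :: real
  assumes "d > 0" "0 \<le> a" "a \<le> 1"
  shows "d powr a \<le> 1 + a * (d - 1)"
proof -
  have "exp ((1 - a) *\<^sub>R 0 + a *\<^sub>R ln d) \<le> (1 - a) * exp 0 + a * exp (ln d)"
    using assms by (intro convex_onD[OF exp_convex]) auto
  with assms show ?thesis by (simp add: powr_def algebra_simps)
qed

lemma powr_gap_below_one: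
  fixes d a :: real
  assumes "0 < d" "0 \<le> a" "a \<le> 1"
  shows "a * (1 - d) \<le> 1 - d powr a"
  using powr_le_affine[OF assms] by (simp add: algebra_simps)

text \<open>The affine upper bound applied to \<open>1 / d\<close> gives a harmonic-mean lower bound on the power of \<open>d\<close>.\<close>

lemma powr_gap_above_one:
  fixes d a :: real
  assumes d: "1 \<le> d" "d \<le> M" and a: "0 \<le> a" "a \<le> 1"
  shows "a * (d - 1) / M \<le> d powr a - 1"
proof -
  define q where "q = 1 + a * (1 / d - 1)"
  have "(1 / d) powr a \<le> q"
    unfolding q_def using d a by (intro powr_le_affine) auto
  moreover have pos: "(1 / d) powr a > 0" using d by simp
  ultimately have q: "q > 0" by linarith
  have "1 / q \<le> d powr a"
    using \<open>(1 / d) powr a \<le> q\<close> d q pos by (simp add: powr_divide field_simps)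
  \<comment> \<open>This is \<open>(q - 1)\<^sup>2 \<ge> 0\<close> divided by \<open>q\<close>.\<close>
  moreover have "2 - q \<le> 1 / q"
    using q zero_le_power2[of "q - 1"] by (simp add: field_simps power2_eq_square)
  moreover have "a * (d - 1) / M \<le> a * (d - 1) / d"
    using d a by (intro divide_left_mono) auto
  moreover have "a * (d - 1) / d = 1 - q"
    unfolding q_def using d by (simp add: field_simps)
  ultimately show ?thesis by linarith
qed

text \<open>The loss of \<open>1 + d\<close> under one averaging step factors, and for \<open>0 < g < 1\<close> both
  factors have the sign of \<open>1 - d\<close>.\<close>

lemma powr_gap_product:
  fixes d g :: real
  assumes "d > 0"
  shows "1 + d - d powr g - d powr (1 - g) = (1 - d powr g) * (1 - d powr (1 - g))"
proof -
  have "d powr g * d powr (1 - g) = d" using assms by (simp flip: powr_add)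
  then show ?thesis by (simp add: algebra_simps)
qed

text \<open>One factor of the product is at least of order \<open>g * \<bar>1 - d\<bar>\<close>, the other at least of order
  \<open>(1 - g) * \<bar>1 - d\<bar>\<close>, and \<open>1 - g \<ge> 1/2\<close>. So the loss is linear in the step size: this is what makes
  divergence of the sum of the steps the condition that forces consensus.\<close>

lemma geodesic_gap_lower_bound:
  fixes d g :: real
  assumes d: "0 < d" "d \<le> M" and M: "1 \<le> M" and g: "0 \<le> g" "g \<le> 1/2"
  shows "g / (2 * M\<^sup>2) * (1 - d)\<^sup>2 \<le> 1 + d - d powr g - d powr (1 - g)"
proof -
  have half: "g / (2 * M\<^sup>2) * (1 - d)\<^sup>2 \<le> g * (1 - g) * (1 - d)\<^sup>2 / M\<^sup>2"
  proof -
    have "g * (1/2) \<le> g * (1 - g)" using g by (intro mult_left_mono) auto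
    then have "g * (1/2) * ((1 - d)\<^sup>2 / M\<^sup>2) \<le> g * (1 - g) * ((1 - d)\<^sup>2 / M\<^sup>2)"
      by (intro mult_right_mono) auto
    then show ?thesis by (simp add: mult.commute mult.assoc)
  qed
  show ?thesis
  proof (cases "d \<le> 1")
    case True
    have "(g * (1 - d)) * ((1 - g) * (1 - d)) \<le> (1 - d powr g) * (1 - d powr (1 - g))"
      using d g True powr_gap_below_one[of d g] powr_gap_below_one[of d "1 - g"]
      by (intro mult_mono') auto
    moreover have "g * (1 - g) * (1 - d)\<^sup>2 / M\<^sup>2 \<le> g * (1 - g) * (1 - d)\<^sup>2 / 1"
      using M g by (intro divide_left_mono) auto
    ultimately show ?thesis
      using half unfolding powr_gap_product[OF d(1)] by (simp add: power2_eq_square mult_ac)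
  next
    case False
    have "(g * (d - 1) / M) * ((1 - g) * (d - 1) / M) \<le> (d powr g - 1) * (d powr (1 - g) - 1)"
      using d g False M powr_gap_above_one[of d M g] powr_gap_above_one[of d M "1 - g"]
      by (intro mult_mono') auto
    moreover have "(1 - d)\<^sup>2 = (d - 1)\<^sup>2" by (simp add: power2_commute)
    moreover have "(1 - d powr g) * (1 - d powr (1 - g)) = (d powr g - 1) * (d powr (1 - g) - 1)"
      by (simp add: algebra_simps)
    ultimately show ?thesis
      using half unfolding powr_gap_product[OF d(1)] by (simp add: power2_eq_square mult_ac)
  qed
qed

definition averaging_loss :: "real^'n^'n \<Rightarrow> real^'n^'n \<Rightarrow> real \<Rightarrow> real^'n \<Rightarrow> real" where
  "averaging_loss A B g x =
     x \<bullet> ((A + B - geodesic_point A B g - geodesic_point B A g) *v x)"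

lemma averaging_loss_congr_diag:
  fixes P :: "real^'n^'n"
  assumes P: "invertible P" and d: "\<And>k. d k > 0"
  shows "averaging_loss (P ** transpose P) (congr_diag P d) g x
    = (\<Sum>k\<in>UNIV. (1 + d k - d k powr g - d k powr (1 - g)) * ((x v* P) $ k)\<^sup>2)"
  unfolding averaging_loss_def geodesic_point_congr_diag[OF assms] geodesic_point_congr_diag_rev[OF assms]
  by (simp only: congr_diag_one[symmetric] congr_diag_add congr_diag_diff quadratic_congr_diag)

lemma averaging_loss_nonneg:
  assumes "A \<in> posdef_matrices" "B \<in> posdef_matrices" "0 \<le> g" "g \<le> 1/2"
  shows "0 \<le> averaging_loss A B g x"
proof -
  obtain P d where P: "invertible P" "\<And>k. d k > 0" "A = P ** transpose P" "B = congr_diag P d"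
    using simultaneous_diagonalization[OF assms(1,2)] by blast
  show ?thesis
    unfolding P(3,4) averaging_loss_congr_diag[OF P(1,2)]
  proof (intro sum_nonneg mult_nonneg_nonneg zero_le_power2)
    fix k
    have "0 \<le> g / (2 * (max 1 (d k))\<^sup>2) * (1 - d k)\<^sup>2" using assms by simp
    also have "\<dots> \<le> 1 + d k - d k powr g - d k powr (1 - g)"
      using P(2) assms by (intro geodesic_gap_lower_bound) auto
    finally show "0 \<le> 1 + d k - d k powr g - d k powr (1 - g)" .
  qed
qed

text \<open>In common diagonal coordinates the loss is a weighted sum of the scalar losses, so up to a
  constant it dominates \<open>g\<close> times
  \<open>\<Sum>k. (1 - d k)\<^sup>2 * ((x v* P) $ k)\<^sup>2\<close>, the squared norm of the vector that \<open>P\<close> maps to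
  \<open>(A - B) *v x\<close>. The bounds on \<open>A\<close> and \<open>B\<close> control both the norm of \<open>P\<close> and the spectrum \<open>d\<close>.\<close>

lemma averaging_loss_lower_bound:
  assumes A: "A \<in> posdef_matrices" and B: "B \<in> posdef_matrices" and g: "0 \<le> g" "g \<le> 1/2"
    and upA: "\<And>x. x \<bullet> (A *v x) \<le> K * (norm x)\<^sup>2" and upB: "\<And>x. x \<bullet> (B *v x) \<le> K * (norm x)\<^sup>2"
    and loA: "\<And>x. (norm x)\<^sup>2 \<le> K' * (x \<bullet> (A *v x))" and K: "0 \<le> K"
  shows "g * (norm ((A - B) *v x))\<^sup>2 \<le> 2 * K * (max 1 (K * K'))\<^sup>2 * averaging_loss A B g x"
proof -
  obtain P d where P: "invertible P" "\<And>k. d k > 0" "A = P ** transpose P" "B = congr_diag P d"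
    using simultaneous_diagonalization[OF A B] by blast
  have A_diag: "A = congr_diag P (\<lambda>k. 1)" using P(3) by (simp add: congr_diag_one)
  define M where "M = max 1 (K * K')"
  have dM: "d k \<le> M" for k
  proof -
    \<comment> \<open>At the vector dual to the \<open>k\<close>-th column of \<open>P\<close> the forms of \<open>A\<close> and \<open>B\<close> are \<open>1\<close> and \<open>d k\<close>.\<close>
    obtain v where v: "v v* P = axis k 1" using dual_vector_exists[OF P(1)] .
    have "v \<bullet> (congr_diag P e *v v) = e k" for e
      unfolding quadratic_congr_diag v
      by (simp add: axis_def if_distrib[where f="\<lambda>x. x\<^sup>2"] if_distrib[where f="(*) _"] cong: if_cong)
    then have "v \<bullet> (A *v v) = 1" "v \<bullet> (B *v v) = d k" using A_diag P(4) by auto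
    with upB[of v] loA[of v] have "d k \<le> K * (norm v)\<^sup>2" "(norm v)\<^sup>2 \<le> K'" by auto
    then have "d k \<le> K * K'" using K by (meson mult_left_mono order_trans)
    then show ?thesis unfolding M_def by simp
  qed
  \<comment> \<open>Hence \<open>K\<close> bounds the squared norm of \<open>transpose P\<close>, which is also that of \<open>P\<close>.\<close>
  have gram: "(norm (v v* P))\<^sup>2 = v \<bullet> (A *v v)" for v
    unfolding A_diag quadratic_congr_diag
    unfolding power2_norm_eq_inner inner_vec_def by (simp add: power2_eq_square)
  define z where "z = (\<chi> k. (1 - d k) * (x v* P) $ k)"
  define u where "u = (A - B) *v x"
  have u: "(norm u)\<^sup>2 \<le> K * (norm z)\<^sup>2"
  proof (cases "u = 0")
    case False
    have "(norm u)\<^sup>2 = u \<bullet> (congr_diag P (\<lambda>k. 1 - d k) *v x)"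
      by (simp add: power2_norm_eq_inner u_def A_diag P(4) congr_diag_diff)
    also have "\<dots> = (u v* P) \<bullet> z"
      unfolding inner_congr_diag z_def by (simp add: inner_vec_def mult_ac)
    also have "\<dots> \<le> norm (u v* P) * norm z" by (rule norm_cauchy_schwarz)
    finally have "((norm u)\<^sup>2)\<^sup>2 \<le> (norm (u v* P) * norm z)\<^sup>2"
      by (intro power_mono) auto
    also have "\<dots> \<le> (K * (norm u)\<^sup>2) * (norm z)\<^sup>2"
      unfolding power_mult_distrib gram by (intro mult_right_mono upA) auto
    finally have "(norm u)\<^sup>2 * (norm u)\<^sup>2 \<le> (norm u)\<^sup>2 * (K * (norm z)\<^sup>2)"
      by (simp only: power2_eq_square mult_ac)
    moreover have "0 < (norm u)\<^sup>2" using False by simp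
    ultimately show ?thesis by (rule mult_left_le_imp_le)
  qed (use K in simp)
  have "g / (2 * M\<^sup>2) * (norm z)\<^sup>2 = (\<Sum>k\<in>UNIV. g / (2 * M\<^sup>2) * (1 - d k)\<^sup>2 * ((x v* P) $ k)\<^sup>2)"
    unfolding power2_norm_eq_inner inner_vec_def z_def
    by (simp add: sum_distrib_left power2_eq_square mult_ac)
  also have "\<dots> \<le> averaging_loss A B g x"
    unfolding P(3,4) averaging_loss_congr_diag[OF P(1,2)]
    using P(2) dM g by (intro sum_mono mult_right_mono geodesic_gap_lower_bound) (auto simp: M_def)
  finally have "g * (norm z)\<^sup>2 \<le> 2 * M\<^sup>2 * averaging_loss A B g x"
    by (simp add: M_def field_simps)
  then have "K * (g * (norm z)\<^sup>2) \<le> K * (2 * M\<^sup>2 * averaging_loss A B g x)"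
    using K by (intro mult_left_mono) auto
  moreover have "g * (norm u)\<^sup>2 \<le> g * (K * (norm z)\<^sup>2)"
    using u g by (intro mult_left_mono) auto
  ultimately show ?thesis unfolding u_def M_def by (simp add: mult_ac)
qed

text \<open>Apply the bound on the inverse to the vector \<open>matrix_sqrt A *v x\<close>.\<close>

lemma norm_le_of_inverse_bound:
  assumes A: "A \<in> posdef_matrices"
    and up: "\<And>x. x \<bullet> (matrix_inv A *v x) \<le> K * (norm x)\<^sup>2"
  shows "(norm x)\<^sup>2 \<le> K * (x \<bullet> (A *v x))"
proof -
  define R where "R = matrix_sqrt A"
  have R: "R \<in> posdef_matrices" "R ** R = A" unfolding R_def using A by (rule matrix_sqrt)+
  have sym: "u \<bullet> (R *v v) = (R *v u) \<bullet> v" for u v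
    using R(1) dot_lmul_matrix[of u R v] transpose_matrix_vector[of R u]
    by (simp add: posdef_matrices_def)
  have "(R *v x) \<bullet> (matrix_inv A *v (R *v x)) = x \<bullet> x"
  proof -
    have "matrix_inv A = matrix_inv R ** matrix_inv R"
    proof (rule matrix_inv_eqI)
      have "A ** (matrix_inv R ** matrix_inv R) = R ** (R ** matrix_inv R) ** matrix_inv R"
        by (simp add: R(2)[symmetric] matrix_mul_assoc)
      then show "A ** (matrix_inv R ** matrix_inv R) = mat 1"
        using posdef_invertible[OF R(1)] by (simp add: matrix_inv_mult)
    qed
    then have "R *v (matrix_inv A *v (R *v x)) = ((R ** matrix_inv R) ** (matrix_inv R ** R)) *v x"
      by (simp add: matrix_vector_mul_assoc matrix_mul_assoc)
    then show ?thesis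
      using posdef_invertible[OF R(1)] by (simp add: sym[symmetric] matrix_inv_mult)
  qed
  moreover have "(norm (R *v x))\<^sup>2 = x \<bullet> (A *v x)"
    by (simp add: power2_norm_eq_inner sym[symmetric] matrix_vector_mul_assoc R(2))
  ultimately show ?thesis using up[of "R *v x"] by (simp add: power2_norm_eq_inner)
qed

section \<open>Energy along a run\<close>

lemma posdef_form_nonneg: "A \<in> posdef_matrices \<Longrightarrow> 0 \<le> x \<bullet> (A *v x)"
  by (cases "x = 0") (auto simp: posdef_matrices_def less_imp_le)

lemma axis_form: "axis i 1 \<bullet> ((A::real^'n^'n) *v axis j 1) = A $ i $ j"
  by (simp add: matrix_vector_mult_basis column_def inner_axis')

lemma symmetric_nth:
  assumes "transpose A = A"
  shows "A $ i $ j = A $ j $ i"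
proof -
  have "transpose A $ i $ j = A $ j $ i" by (simp add: transpose_def)
  with assms show ?thesis by simp
qed

text \<open>Loewner-monotone sequences are handled one quadratic form at a time; polarization recovers the
  matrix entries from these forms.\<close>

lemma symmetric_entry_polarization:
  fixes A :: "real^'n^'n"
  assumes "transpose A = A"
  shows "A $ i $ j = ((axis i 1 + axis j 1) \<bullet> (A *v (axis i 1 + axis j 1))
           - axis i 1 \<bullet> (A *v axis i 1) - axis j 1 \<bullet> (A *v axis j 1)) / 2"
proof -
  have "A $ j $ i = A $ i $ j" using assms by (rule symmetric_nth)
  then show ?thesis
    by (simp only: matrix_vector_right_distrib inner_add_left inner_add_right axis_form) simp
qed

lemma norm_matrix_squared:
  fixes A :: "real^'n^'n"
  shows "(norm A)\<^sup>2 = (\<Sum>k\<in>UNIV. (norm (A *v axis k 1))\<^sup>2)"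
proof -
  have "(norm A)\<^sup>2 = (\<Sum>i\<in>UNIV. \<Sum>k\<in>UNIV. A $ i $ k * A $ i $ k)"
    unfolding power2_norm_eq_inner inner_vec_def by simp
  also have "\<dots> = (\<Sum>k\<in>UNIV. \<Sum>i\<in>UNIV. A $ i $ k * A $ i $ k)" by (rule sum.swap)
  finally show ?thesis
    unfolding power2_norm_eq_inner inner_vec_def by (simp add: matrix_vector_mult_basis column_def)
qed

lemma tendsto_matrix_vector_mult:
  fixes A :: "'a \<Rightarrow> real^'n^'n"
  assumes "(A \<longlongrightarrow> L) F"
  shows "((\<lambda>t. A t *v x) \<longlongrightarrow> L *v x) F"
proof -
  have "linear (\<lambda>M::real^'n^'n. M *v x)"
    by (intro linearI) (simp_all add: matrix_vector_mult_add_rdistrib scaleR_matrix_vector_assoc)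
  then have "bounded_linear (\<lambda>M::real^'n^'n. M *v x)"
    by (simp add: linear_conv_bounded_linear)
  from bounded_linear.tendsto[OF this assms] show ?thesis .
qed

lemma tendsto_matrixI:
  fixes A :: "'a \<Rightarrow> real^'n^'n"
  assumes "\<And>x. ((\<lambda>t. A t *v x) \<longlongrightarrow> L *v x) F"
  shows "(A \<longlongrightarrow> L) F"
proof (intro vec_tendstoI)
  fix i j
  have "((\<lambda>t. axis i 1 \<bullet> (A t *v axis j 1)) \<longlongrightarrow> axis i 1 \<bullet> (L *v axis j 1)) F"
    by (intro tendsto_intros assms)
  then show "((\<lambda>t. A t $ i $ j) \<longlongrightarrow> L $ i $ j) F" by (simp add: axis_form)
qed

lemma symmetric_matrix_seq_convergent:
  fixes A :: "nat \<Rightarrow> real^'n^'n"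
  assumes sym: "\<And>t. transpose (A t) = A t" and conv: "\<And>x. convergent (\<lambda>t. x \<bullet> (A t *v x))"
  obtains L where "transpose L = L" "A \<longlonglongrightarrow> L"
proof -
  have "convergent (\<lambda>t. A t $ i $ j)" for i j
    unfolding symmetric_entry_polarization[OF sym] divide_inverse
    by (intro convergent_diff conv convergent_mult convergent_const)
  then obtain l where l: "\<And>i j. (\<lambda>t. A t $ i $ j) \<longlonglongrightarrow> l i j"
    unfolding convergent_def by metis
  define L where "L = (\<chi> i j. l i j)"
  have AL: "A \<longlonglongrightarrow> L" unfolding L_def by (intro vec_tendstoI) (simp add: l)
  have "l i j = l j i" for i j
  proof (rule LIMSEQ_unique[OF l])
    have "A t $ i $ j = A t $ j $ i" for t using sym by (rule symmetric_nth)
    then show "(\<lambda>t. A t $ i $ j) \<longlonglongrightarrow> l j i" using l[of j i] by simp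
  qed
  then have "transpose L = L" by (simp add: L_def transpose_def vec_eq_iff)
  with AL that show thesis by blast
qed

text \<open>A deterministic run: the sequence \<open>s\<close> of chosen nodes is arbitrary. All estimates on runs hold for
  every such sequence, and randomness enters only afterwards.\<close>

locale gossip_run =
  fixes m :: nat and \<gamma> :: "nat \<Rightarrow> real" and s :: "nat \<Rightarrow> nat" and W0 :: "nat \<Rightarrow> real^'n^'n"
  assumes node: "s t \<in> {1..m-1}"
    and init: "j \<in> {1..m} \<Longrightarrow> W0 j \<in> posdef_matrices"
    and step_pos: "0 < \<gamma> t" and step_le: "\<gamma> t \<le> 1/2"
begin

abbreviation W :: "nat \<Rightarrow> nat \<Rightarrow> real^'n^'n" where "W \<equiv> gossip \<gamma> s W0"

text \<open>The quadratic form of the sum of all matrices held by the nodes. The sum itself would be conserved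
  by linear averaging; geodesic averaging makes it decrease in the Loewner order.\<close>

definition energy :: "nat \<Rightarrow> real^'n \<Rightarrow> real" where
  "energy t x = (\<Sum>j\<in>{1..m}. x \<bullet> (W t j *v x))"

lemma node_in: "s t \<in> {1..m}" "s t + 1 \<in> {1..m}"
  using node[of t] by auto

lemma W_posdef: "j \<in> {1..m} \<Longrightarrow> W t j \<in> posdef_matrices"
proof (induction t arbitrary: j)
  case (Suc t)
  then show ?case using node_in[of t] by (simp add: gossip_step_def geodesic_point_posdef)
qed (simp add: init)

lemma gossip_matrix_inv:
  "j \<in> {1..m} \<Longrightarrow> gossip \<gamma> s (\<lambda>j. matrix_inv (W0 j)) t j = matrix_inv (W t j)"
proof (induction t arbitrary: j)
  case (Suc t)
  then show ?case using node_in[of t] W_posdef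
    by (simp add: gossip_step_def geodesic_point_matrix_inv)
qed simp

text \<open>Interpreting the locale at the inverse matrices transfers the monotonicity of the energy to the sum
  of the inverses.\<close>

lemma inverse_run: "gossip_run m \<gamma> s (\<lambda>j. matrix_inv (W0 j))"
  using node init step_pos step_le by unfold_locales (auto intro: posdef_matrix_inv)

lemma energy_Suc:
  "energy (Suc t) x = energy t x - averaging_loss (W t (s t)) (W t (s t + 1)) (\<gamma> t) x"
proof -
  let ?e = "{s t, s t + 1}"
  have sub: "?e \<subseteq> {1..m}" using node_in[of t] by auto
  have split: "energy u x = (\<Sum>j\<in>{1..m} - ?e. x \<bullet> (W u j *v x))
      + (x \<bullet> (W u (s t) *v x) + x \<bullet> (W u (s t + 1) *v x))" for u
    unfolding energy_def by (subst sum.subset_diff[OF sub]) auto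
  have "(\<Sum>j\<in>{1..m} - ?e. x \<bullet> (W (Suc t) j *v x)) = (\<Sum>j\<in>{1..m} - ?e. x \<bullet> (W t j *v x))"
    by (intro sum.cong) (auto simp: gossip_step_def)
  then show ?thesis
    unfolding split[of t] split[of "Suc t"]
    by (simp add: gossip_step_def averaging_loss_def matrix_vector_mult_add_rdistrib
        matrix_vector_mult_diff_rdistrib inner_diff_right inner_add_right)
qed

lemma drop_nonneg: "0 \<le> averaging_loss (W t (s t)) (W t (s t + 1)) (\<gamma> t) x"
  using W_posdef node_in[of t] step_pos[of t] step_le[of t] by (intro averaging_loss_nonneg) auto

lemma energy_decseq: "decseq (\<lambda>t. energy t x)"
  using drop_nonneg by (intro decseq_SucI) (simp add: energy_Suc)

lemma energy_nonneg: "0 \<le> energy t x"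
  unfolding energy_def by (intro sum_nonneg posdef_form_nonneg W_posdef)

lemma energy_convergent: "convergent (\<lambda>t. energy t x)"
  using decseq_convergent[OF energy_decseq allI[OF energy_nonneg]] by (metis convergentI)

lemma form_le_energy: "j \<in> {1..m} \<Longrightarrow> x \<bullet> (W t j *v x) \<le> energy t x"
  unfolding energy_def
  by (rule member_le_sum[where f="\<lambda>j. x \<bullet> (W t j *v x)"]) (auto intro!: posdef_form_nonneg W_posdef)

lemma energy_le_initial: "energy t x \<le> energy 0 x"
  using energy_decseq by (simp add: decseq_def)

lemma form_le_initial: "j \<in> {1..m} \<Longrightarrow> x \<bullet> (W t j *v x) \<le> energy 0 x"
  using form_le_energy energy_le_initial order_trans by blast

lemma sum_drop: "(\<Sum>t<T. averaging_loss (W t (s t)) (W t (s t + 1)) (\<gamma> t) x) = energy 0 x - energy T x"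
  by (induction T) (simp_all add: energy_Suc)

end

lemma form_le_norm_squared:
  fixes A :: "'a \<Rightarrow> real^'n^'n"
  assumes "finite S"
  obtains K where "0 < K" "\<And>x. (\<Sum>j\<in>S. x \<bullet> (A j *v x)) \<le> K * (norm x)\<^sup>2"
proof
  let ?K = "1 + (\<Sum>j\<in>S. onorm ((*v) (A j)))"
  have "x \<bullet> (A j *v x) \<le> onorm ((*v) (A j)) * (norm x)\<^sup>2" for x j
  proof -
    have "x \<bullet> (A j *v x) \<le> norm x * norm (A j *v x)" by (rule norm_cauchy_schwarz)
    also have "\<dots> \<le> norm x * (onorm ((*v) (A j)) * norm x)"
      by (intro mult_left_mono onorm) auto
    finally show ?thesis by (simp add: power2_eq_square mult_ac)
  qed
  then have "(\<Sum>j\<in>S. x \<bullet> (A j *v x)) \<le> (\<Sum>j\<in>S. onorm ((*v) (A j))) * (norm x)\<^sup>2" for x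
    unfolding sum_distrib_right by (intro sum_mono) auto
  then show "(\<Sum>j\<in>S. x \<bullet> (A j *v x)) \<le> ?K * (norm x)\<^sup>2" for x
    unfolding distrib_right by (rule add_increasing[rotated]) simp
  show "0 < ?K"
    by (intro add_pos_nonneg sum_nonneg onorm_pos_le) auto
qed

text \<open>The constant depends only on the initial matrices, not on the sequence of chosen nodes. This
  uniformity is needed for taking expectations.\<close>

lemma gossip_bounds:
  fixes W0 :: "nat \<Rightarrow> real^'n^'n"
  obtains K where "0 < K"
    "\<And>\<gamma> s t j x. gossip_run m \<gamma> s W0 \<Longrightarrow> j \<in> {1..m} \<Longrightarrow>
       x \<bullet> (gossip \<gamma> s W0 t j *v x) \<le> K * (norm x)\<^sup>2"
    "\<And>\<gamma> s t j x. gossip_run m \<gamma> s W0 \<Longrightarrow> j \<in> {1..m} \<Longrightarrow>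
       x \<bullet> (matrix_inv (gossip \<gamma> s W0 t j) *v x) \<le> K * (norm x)\<^sup>2"
    "\<And>\<gamma> s x. gossip_run m \<gamma> s W0 \<Longrightarrow> gossip_run.energy m \<gamma> s W0 0 x \<le> K * (norm x)\<^sup>2"
proof -
  obtain K1 where K1: "0 < K1" "\<And>x. (\<Sum>j\<in>{1..m}. x \<bullet> (W0 j *v x)) \<le> K1 * (norm x)\<^sup>2"
    using form_le_norm_squared[of "{1..m}" W0] by blast
  obtain K2 where K2: "0 < K2" "\<And>x. (\<Sum>j\<in>{1..m}. x \<bullet> (matrix_inv (W0 j) *v x)) \<le> K2 * (norm x)\<^sup>2"
    using form_le_norm_squared[of "{1..m}" "\<lambda>j. matrix_inv (W0 j)"] by blast
  let ?K = "max K1 K2"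
  have up: "K1 * (norm x)\<^sup>2 \<le> ?K * (norm x)\<^sup>2" "K2 * (norm x)\<^sup>2 \<le> ?K * (norm x)\<^sup>2" for x :: "real^'n"
    by (intro mult_right_mono; simp)+
  show thesis
  proof (rule that[of ?K])
    fix \<gamma> s t j and x :: "real^'n"
    assume run: "gossip_run m \<gamma> s W0"
    interpret gossip_run m \<gamma> s W0 by (rule run)
    interpret inv: gossip_run m \<gamma> s "\<lambda>j. matrix_inv (W0 j)" by (rule inverse_run)
    show e: "energy 0 x \<le> ?K * (norm x)\<^sup>2"
      unfolding energy_def using K1(2)[of x] up(1)[of x] by simp
    assume j: "j \<in> {1..m}"
    show "x \<bullet> (W t j *v x) \<le> ?K * (norm x)\<^sup>2"
      using form_le_initial[OF j] e order_trans by blast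
    have "inv.energy 0 x \<le> ?K * (norm x)\<^sup>2"
      unfolding inv.energy_def using K2(2)[of x] up(2)[of x] by simp
    then show "x \<bullet> (matrix_inv (W t j) *v x) \<le> ?K * (norm x)\<^sup>2"
      using inv.form_le_initial[OF j, of x t] gossip_matrix_inv[OF j, of t] by simp
  qed (use K1 in auto)
qed

text \<open>The energy is nonnegative and bounded by its initial value, so its total loss is bounded, and each
  loss dominates the step size times the squared disagreement of the two nodes that are averaged. Summing over the
  vectors of the standard basis replaces the quadratic forms by the norm of the matrices.\<close>

lemma gossip_dissipation_bounded:
  fixes W0 :: "nat \<Rightarrow> real^'n^'n"
  shows "\<exists>C. \<forall>s. gossip_run m \<gamma> s W0 \<longrightarrow> (\<forall>T.
      (\<Sum>t<T. \<gamma> t * (norm (gossip \<gamma> s W0 t (s t) - gossip \<gamma> s W0 t (s t + 1)))\<^sup>2) \<le> C)"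
proof -
  obtain K where K: "0 < K"
    "\<And>\<gamma> s t j x. gossip_run m \<gamma> s W0 \<Longrightarrow> j \<in> {1..m} \<Longrightarrow>
       x \<bullet> (gossip \<gamma> s W0 t j *v x) \<le> K * (norm x)\<^sup>2"
    "\<And>\<gamma> s t j x. gossip_run m \<gamma> s W0 \<Longrightarrow> j \<in> {1..m} \<Longrightarrow>
       x \<bullet> (matrix_inv (gossip \<gamma> s W0 t j) *v x) \<le> K * (norm x)\<^sup>2"
    "\<And>\<gamma> s x. gossip_run m \<gamma> s W0 \<Longrightarrow> gossip_run.energy m \<gamma> s W0 0 x \<le> K * (norm x)\<^sup>2"
    using gossip_bounds[where m=m and ?W0.0=W0] by metis
  define c where "c = 2 * K * (max 1 (K * K))\<^sup>2"
  show ?thesis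
  proof (intro exI[of _ "CARD('n) * (c * K)"] allI impI)
    fix s T assume run: "gossip_run m \<gamma> s W0"
    interpret gossip_run m \<gamma> s W0 by (rule run)
    let ?D = "\<lambda>t. W t (s t) - W t (s t + 1)"
    have c: "0 \<le> c" unfolding c_def using K(1) by simp
    have "(\<Sum>t<T. \<gamma> t * (norm (?D t *v x))\<^sup>2) \<le> c * K * (norm x)\<^sup>2" for x
    proof -
      have "(\<Sum>t<T. \<gamma> t * (norm (?D t *v x))\<^sup>2)
          \<le> (\<Sum>t<T. c * averaging_loss (W t (s t)) (W t (s t + 1)) (\<gamma> t) x)"
      proof (rule sum_mono)
        fix t
        show "\<gamma> t * (norm (?D t *v x))\<^sup>2 \<le> c * averaging_loss (W t (s t)) (W t (s t + 1)) (\<gamma> t) x"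
          unfolding c_def
          using node_in[of t] step_pos[of t] step_le[of t] K(1)
          by (intro averaging_loss_lower_bound norm_le_of_inverse_bound W_posdef K(2,3)[OF run]) auto
      qed
      also have "\<dots> = c * (energy 0 x - energy T x)"
        by (simp only: sum_drop sum_distrib_left[symmetric])
      also have "\<dots> \<le> c * (K * (norm x)\<^sup>2)"
        using c K(4)[OF run, of x] energy_nonneg[of T x] by (intro mult_left_mono) auto
      finally show ?thesis by (simp add: mult_ac)
    qed
    from this[of "axis k 1" for k]
    have "(\<Sum>k\<in>UNIV. \<Sum>t<T. \<gamma> t * (norm (?D t *v axis k 1))\<^sup>2) \<le> (\<Sum>k\<in>(UNIV::'n set). c * K)"
      by (intro sum_mono) (simp add: norm_axis_1)
    then show "(\<Sum>t<T. \<gamma> t * (norm (?D t))\<^sup>2) \<le> CARD('n) * (c * K)"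
      unfolding norm_matrix_squared sum_distrib_left by (subst sum.swap) simp
  qed
qed

section \<open>Sampling a process by independent choices\<close>

text \<open>A function of the choices before time \<open>t\<close> is independent of the choice at time \<open>t\<close>. As there are
  finitely many possible choices, such a function takes finitely many values; therefore it is measurable and
  bounded.\<close>

lemma (in prob_space) expectation_mult_indicator_next:
  fixes I :: "nat \<Rightarrow> 'a \<Rightarrow> 'b" and F :: "(nat \<Rightarrow> 'b) \<Rightarrow> real"
  assumes fin: "finite A" and indep: "indep_vars (\<lambda>_. count_space A) I UNIV"
    and F_past: "\<And>s s'. (\<And>u. u < t \<Longrightarrow> s u = s' u) \<Longrightarrow> F s = F s'"
  shows "integrable M (\<lambda>\<omega>. F (\<lambda>u. I u \<omega>))"
    and "integrable M (\<lambda>\<omega>. F (\<lambda>u. I u \<omega>) * of_bool (I t \<omega> = i))"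
    and "(\<integral>\<omega>. F (\<lambda>u. I u \<omega>) * of_bool (I t \<omega> = i) \<partial>M)
           = (\<integral>\<omega>. F (\<lambda>u. I u \<omega>) \<partial>M) * prob {\<omega> \<in> space M. I t \<omega> = i}"
proof -
  let ?past = "\<lambda>\<omega>. restrict (\<lambda>u. I u \<omega>) {..<t}" and ?now = "\<lambda>\<omega>. restrict (\<lambda>u. I u \<omega>) {t}"
  let ?N = "\<lambda>J. \<Pi>\<^sub>M u\<in>J. count_space A"
  have meas: "I u \<in> measurable M (count_space A)" for u
    using indep by (simp add: indep_vars_def)
  have count: "?N J = count_space (PiE J (\<lambda>_. A))" if "finite J" for J :: "nat set"
    using that fin by (intro count_space_PiM_finite) (auto intro: countable_finite)
  have past: "F (?past \<omega>) = F (\<lambda>u. I u \<omega>)" for \<omega> by (rule F_past) simp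
  have "indep_var (?N {..<t}) ?past (?N {t}) ?now"
    using indep by (rule indep_var_restrict) auto
  then have "indep_var borel (F \<circ> ?past) borel ((\<lambda>r. of_bool (r t = i) :: real) \<circ> ?now)"
    by (rule indep_var_compose) (simp_all add: count)
  then have ind: "indep_var borel (\<lambda>\<omega>. F (\<lambda>u. I u \<omega>)) borel (\<lambda>\<omega>. of_bool (I t \<omega> = i) :: real)"
    by (simp add: comp_def past)
  have mF: "(\<lambda>\<omega>. F (\<lambda>u. I u \<omega>)) \<in> borel_measurable M"
    using ind by (simp add: indep_var_rv1)
  have mI: "(\<lambda>\<omega>. of_bool (I t \<omega> = i) :: real) \<in> borel_measurable M"
    using ind by (simp add: indep_var_rv2)
  have "finite (F ` PiE {..<t} (\<lambda>_. A))" using fin by (intro finite_imageI finite_PiE) auto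
  then obtain B where B: "\<And>r. r \<in> PiE {..<t} (\<lambda>_. A) \<Longrightarrow> \<bar>F r\<bar> \<le> B"
    using finite_imp_bounded[of "F ` PiE {..<t} (\<lambda>_. A)"] by (auto simp: bounded_iff)
  have "\<bar>F (\<lambda>u. I u \<omega>)\<bar> \<le> B" if "\<omega> \<in> space M" for \<omega>
    using B[of "?past \<omega>"] measurable_space[OF meas that] by (simp add: past)
  then show iF: "integrable M (\<lambda>\<omega>. F (\<lambda>u. I u \<omega>))"
    using mF by (intro integrable_const_bound[where B=B]) auto
  have iI: "integrable M (\<lambda>\<omega>. of_bool (I t \<omega> = i) :: real)"
    using mI by (intro integrable_const_bound[where B=1]) auto
  show "integrable M (\<lambda>\<omega>. F (\<lambda>u. I u \<omega>) * of_bool (I t \<omega> = i))"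
    by (rule indep_var_integrable[OF ind iF iI])
  have "(\<lambda>\<omega>. of_bool (I t \<omega> = i) :: real) = indicator {\<omega>. I t \<omega> = i}"
    by (auto simp: indicator_def)
  then have "(\<integral>\<omega>. of_bool (I t \<omega> = i) \<partial>M) = prob {\<omega> \<in> space M. I t \<omega> = i}"
    by (simp add: Int_def conj_commute)
  then show "(\<integral>\<omega>. F (\<lambda>u. I u \<omega>) * of_bool (I t \<omega> = i) \<partial>M)
           = (\<integral>\<omega>. F (\<lambda>u. I u \<omega>) \<partial>M) * prob {\<omega> \<in> space M. I t \<omega> = i}"
    using indep_var_lebesgue_integral[OF ind iF iI] by simp
qed

text \<open>In expectation, independence replaces the indicator of the choice of \<open>i\<close> by its probability \<open>q\<close>.
  So the expectation of the full series is at most \<open>C / q\<close>, and a nonnegative series with finite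
  expectation converges almost surely.\<close>

lemma (in prob_space) AE_summable_of_sampled_bound:
  fixes I :: "nat \<Rightarrow> 'a \<Rightarrow> 'b" and F :: "nat \<Rightarrow> (nat \<Rightarrow> 'b) \<Rightarrow> real"
  assumes fin: "finite A" and indep: "indep_vars (\<lambda>_. count_space A) I UNIV"
    and q: "0 < q" "\<And>t. prob {\<omega> \<in> space M. I t \<omega> = i} = q"
    and F_past: "\<And>t s s'. (\<And>u. u < t \<Longrightarrow> s u = s' u) \<Longrightarrow> F t s = F t s'"
    and F_nonneg: "\<And>t s. 0 \<le> F t s"
    and bound: "\<And>s T. (\<And>t. s t \<in> A) \<Longrightarrow> (\<Sum>t<T. F t s * of_bool (s t = i)) \<le> C"
  shows "AE \<omega> in M. summable (\<lambda>t. F t (\<lambda>u. I u \<omega>))"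
proof -
  let ?F = "\<lambda>t \<omega>. F t (\<lambda>u. I u \<omega>)"
  note next_step = expectation_mult_indicator_next[OF fin indep F_past]
  have meas: "I u \<in> measurable M (count_space A)" for u
    using indep by (simp add: indep_vars_def)
  have int: "integrable M (?F t)" for t by (rule next_step(1))
  have [measurable]: "?F t \<in> borel_measurable M" for t using int[of t] by simp
  have sampled: "(\<integral>\<omega>. ?F t \<omega> * of_bool (I t \<omega> = i) \<partial>M) = (\<integral>\<omega>. ?F t \<omega> \<partial>M) * q" for t
    using expectation_mult_indicator_next(3)[where F="F t" and t=t and i=i, OF fin indep F_past]
    by (simp only: q(2))
  have part: "(\<Sum>t<T. \<integral>\<omega>. ?F t \<omega> \<partial>M) \<le> C / q" for T
  proof -
    have "(\<Sum>t<T. \<integral>\<omega>. ?F t \<omega> \<partial>M) * q = (\<Sum>t<T. \<integral>\<omega>. ?F t \<omega> * of_bool (I t \<omega> = i) \<partial>M)"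
      unfolding sum_distrib_right by (intro sum.cong) (simp_all only: sampled)
    also have "\<dots> = (\<integral>\<omega>. (\<Sum>t<T. ?F t \<omega> * of_bool (I t \<omega> = i)) \<partial>M)"
      by (intro Bochner_Integration.integral_sum[symmetric] next_step(2))
    also have "\<dots> \<le> (\<integral>\<omega>. C \<partial>M)"
      using measurable_space[OF meas]
      by (intro integral_mono Bochner_Integration.integrable_sum next_step(2) bound) auto
    finally show ?thesis using q(1) by (simp add: prob_space pos_le_divide_eq)
  qed
  have "(\<integral>\<^sup>+\<omega>. (\<Sum>t. ennreal (?F t \<omega>)) \<partial>M) = (\<Sum>t. \<integral>\<^sup>+\<omega>. ennreal (?F t \<omega>) \<partial>M)"
    by (intro nn_integral_suminf) measurable
  also have "\<dots> = (\<Sum>t. ennreal (\<integral>\<omega>. ?F t \<omega> \<partial>M))"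
    by (intro suminf_cong nn_integral_eq_integral int) (simp add: F_nonneg)
  also have "\<dots> \<le> ennreal (C / q)"
  proof (rule suminf_le_const)
    fix T
    show "(\<Sum>t<T. ennreal (\<integral>\<omega>. ?F t \<omega> \<partial>M)) \<le> ennreal (C / q)"
      using part[of T] by (subst sum_ennreal) (auto intro!: ennreal_leI integral_nonneg simp: F_nonneg)
  qed simp
  finally have "(\<integral>\<^sup>+\<omega>. (\<Sum>t. ennreal (?F t \<omega>)) \<partial>M) \<noteq> \<infinity>"
    by (metis ennreal_neq_top infinity_ennreal_def top.extremum_uniqueI)
  then have "AE \<omega> in M. (\<Sum>t. ennreal (?F t \<omega>)) \<noteq> \<infinity>"
    by (intro nn_integral_noteq_infinite) measurable
  then show ?thesis
    by eventually_elim (auto intro: summable_suminf_not_top simp: F_nonneg)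
qed

section \<open>Consensus and convergence\<close>

text \<open>Otherwise \<open>D\<close> would eventually stay above some \<open>e > 0\<close> and the weights \<open>g\<close> themselves would be summable.\<close>

lemma frequently_small_of_summable_weights:
  fixes g D :: "nat \<Rightarrow> real"
  assumes g: "\<And>t. 0 < g t" and D: "\<And>t. 0 \<le> D t"
    and div: "filterlim (\<lambda>T. \<Sum>t<T. g t) at_top sequentially"
    and summ: "summable (\<lambda>t. g t * D t)"
  obtains r where "filterlim r at_top sequentially" "(\<lambda>n. D (r n)) \<longlonglongrightarrow> 0"
proof -
  have ex: "\<exists>t\<ge>N. D t < e" if e: "0 < e" for e N
  proof (rule ccontr)
    assume "\<not> ?thesis"
    then have large: "e \<le> D t" if "N \<le> t" for t using that by (meson not_le)
    have "summable g"
    proof (rule summable_comparison_test')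
      show "summable (\<lambda>t. (g t * D t) / e)" using summ by (rule summable_divide)
      show "norm (g t) \<le> (g t * D t) / e" if "N \<le> t" for t
        using mult_left_mono[OF large[OF that], of "g t"] g[of t] e by (simp add: pos_le_divide_eq)
    qed
    then have "(\<lambda>T. \<Sum>t<T. g t) \<longlonglongrightarrow> suminf g" by (rule summable_LIMSEQ)
    with div show False
      using not_tendsto_and_filterlim_at_infinity[OF trivial_limit_sequentially]
        filterlim_at_top_imp_at_infinity by blast
  qed
  then have "\<forall>n. \<exists>t. n \<le> t \<and> D t < 1 / real (Suc n)"
    by (metis of_nat_0_less_iff zero_less_Suc zero_less_divide_1_iff)
  then obtain r where r: "\<And>n. n \<le> r n" "\<And>n. D (r n) < 1 / real (Suc n)"
    by metis
  show thesis
  proof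
    show "filterlim r at_top sequentially"
      by (rule filterlim_at_top_mono[OF filterlim_ident]) (simp add: r(1))
    show "(\<lambda>n. D (r n)) \<longlonglongrightarrow> 0"
    proof (rule tendsto_sandwich[OF _ _ tendsto_const])
      show "(\<lambda>n. 1 / real (Suc n)) \<longlonglongrightarrow> 0" by (rule LIMSEQ_Suc[OF lim_1_over_n])
    qed (auto simp: D less_imp_le[OF r(2)] simp del: of_nat_Suc)
  qed
qed

text \<open>Summed over the nodes, the right-hand side involves only the energies of the run and of the inverse
  run, both of which converge. The left-hand side measures the distance of \<open>A\<close> from \<open>L\<close>.\<close>

lemma consensus_form_expansion:
  fixes A L :: "real^'n^'n"
  assumes A: "A \<in> posdef_matrices" and L: "transpose L = L"
  shows "((A - L) *v x) \<bullet> (matrix_inv A *v ((A - L) *v x))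
    = x \<bullet> (A *v x) - 2 * (x \<bullet> (L *v x)) + (L *v x) \<bullet> (matrix_inv A *v (L *v x))"
proof -
  note inv = matrix_inv_mult[OF posdef_invertible[OF A]]
  have sA: "(A *v u) \<bullet> v = u \<bullet> (A *v v)" for u v
    using A dot_lmul_matrix[of u A v] transpose_matrix_vector[of A u]
    by (simp add: posdef_matrices_def)
  have cancel: "A *v (matrix_inv A *v v) = v" for v
    by (simp add: matrix_vector_mul_assoc inv)
  have "matrix_inv A *v ((A - L) *v x) = x - matrix_inv A *v (L *v x)"
    by (simp add: matrix_vector_mult_diff_rdistrib matrix_vector_mult_diff_distrib
        matrix_vector_mul_assoc inv)
  moreover have "(A *v x) \<bullet> (matrix_inv A *v (L *v x)) = x \<bullet> (L *v x)"
    by (simp add: sA cancel)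
  moreover have "(A *v x) \<bullet> x = x \<bullet> (A *v x)" "(L *v x) \<bullet> x = x \<bullet> (L *v x)"
    by (rule inner_commute)+
  ultimately show ?thesis
    by (simp add: matrix_vector_mult_diff_rdistrib inner_diff_left inner_diff_right)
qed

context gossip_run
begin

text \<open>Along the times \<open>r\<close> all matrices approach their mean, which converges because the energy does; this
  gives the candidate limit \<open>L\<close>. To pass to all times, consider the total deviation
  \<open>\<Sum>j. (W t j - L) ** matrix_inv (W t j) ** (W t j - L)\<close>. It has a limit, since it is a combination of
  the two converging energies, and this limit is \<open>0\<close> because it is \<open>0\<close> along \<open>r\<close>. All of its terms
  are positive semidefinite, so each tends to \<open>0\<close>.\<close>

lemma converges_if_neighbours_asymptotically_equal:
  assumes r: "filterlim r at_top sequentially"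
    and close: "\<And>i. i \<in> {1..m-1} \<Longrightarrow> (\<lambda>n. W (r n) i - W (r n) (i + 1)) \<longlonglongrightarrow> 0"
  shows "\<exists>L \<in> posdef_matrices. \<forall>j\<in>{1..m}. (\<lambda>t. W t j) \<longlonglongrightarrow> L"
proof -
  obtain K where K: "0 < K"
    "\<And>t j x. j \<in> {1..m} \<Longrightarrow> x \<bullet> (W t j *v x) \<le> K * (norm x)\<^sup>2"
    "\<And>t j x. j \<in> {1..m} \<Longrightarrow> x \<bullet> (matrix_inv (W t j) *v x) \<le> K * (norm x)\<^sup>2"
    using gossip_bounds[where m=m and ?W0.0=W0] gossip_run_axioms by metis
  interpret inv: gossip_run m \<gamma> s "\<lambda>j. matrix_inv (W0 j)" by (rule inverse_run)
  have m: "0 < m" "1 \<in> {1..m}" using node[of 0] by auto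
  have sym: "transpose (W t j) = W t j" if "j \<in> {1..m}" for t j
    using W_posdef[OF that] by (simp add: posdef_matrices_def)
  define S where "S t = (\<Sum>j\<in>{1..m}. W t j)" for t
  have S_form: "x \<bullet> (S t *v x) = energy t x" for t x
  proof -
    have "(\<Sum>j\<in>J. W t j) *v x = (\<Sum>j\<in>J. W t j *v x)" for J
      by (induction J rule: infinite_finite_induct) (simp_all add: matrix_vector_mult_add_rdistrib)
    then show ?thesis by (simp add: S_def energy_def inner_sum_right)
  qed
  have "transpose (S t) = S t" for t
    using sym symmetric_nth by (auto simp: S_def transpose_def vec_eq_iff intro!: sum.cong)
  then obtain S' where S': "transpose S' = S'" "S \<longlonglongrightarrow> S'"
    using symmetric_matrix_seq_convergent[of S] energy_convergent by (auto simp: S_form)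
  define L where "L = S' /\<^sub>R real m"
  have L_sym: "transpose L = L" by (simp add: L_def transpose_scalar S'(1))
  have from_first: "(\<lambda>n. W (r n) j - W (r n) 1) \<longlonglongrightarrow> 0" if "j \<in> {1..m}" for j
    using that
  proof (induction j)
    case (Suc j)
    show ?case
    proof (cases "j = 0")
      case False
      with Suc.prems have "j \<in> {1..m}" "j \<in> {1..m-1}" by auto
      from tendsto_diff[OF Suc.IH[OF this(1)] close[OF this(2)]] show ?thesis by simp
    qed simp
  qed simp
  have "(\<lambda>n. (S (r n) - (\<Sum>j\<in>{1..m}. W (r n) j - W (r n) 1)) /\<^sub>R real m) \<longlonglongrightarrow> (S' - (\<Sum>j\<in>{1..m}. 0)) /\<^sub>R real m"
    by (intro tendsto_intros from_first filterlim_compose[OF S'(2) r])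
  moreover have "(S t - (\<Sum>j\<in>{1..m}. W t j - W t 1)) /\<^sub>R real m = W t 1" for t
    using m(1) by (simp add: S_def sum_subtractf sum_constant_scaleR del: sum_constant)
  ultimately have first: "(\<lambda>n. W (r n) 1) \<longlonglongrightarrow> L" by (simp add: L_def)
  have sub: "(\<lambda>n. W (r n) j) \<longlonglongrightarrow> L" if "j \<in> {1..m}" for j
    using tendsto_add[OF from_first[OF that] first] by simp

  have full: "(\<lambda>t. W t j) \<longlonglongrightarrow> L" if j: "j \<in> {1..m}" for j
  proof (rule tendsto_matrixI)
    fix x
    define f where "f t j = ((W t j - L) *v x) \<bullet> (matrix_inv (W t j) *v ((W t j - L) *v x))" for t j
    have f_nonneg: "0 \<le> f t j" if "j \<in> {1..m}" for t j
      unfolding f_def using that by (intro posdef_form_nonneg posdef_matrix_inv W_posdef)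
    have f_sum: "(\<Sum>j\<in>{1..m}. f t j)
        = energy t x - real m * (2 * (x \<bullet> (L *v x))) + inv.energy t (L *v x)" for t
    proof -
      have "(\<Sum>j\<in>{1..m}. f t j) = (\<Sum>j\<in>{1..m}. x \<bullet> (W t j *v x) - 2 * (x \<bullet> (L *v x))
          + (L *v x) \<bullet> (matrix_inv (W t j) *v (L *v x)))"
        unfolding f_def by (intro sum.cong consensus_form_expansion W_posdef L_sym) auto
      then show ?thesis
        by (simp add: sum.distrib sum_subtractf energy_def inv.energy_def gossip_matrix_inv)
    qed
    have "convergent (\<lambda>t. \<Sum>j\<in>{1..m}. f t j)"
      unfolding f_sum
      by (intro convergent_add convergent_diff energy_convergent inv.energy_convergent convergent_const)
    then obtain c where c: "(\<lambda>t. \<Sum>j\<in>{1..m}. f t j) \<longlonglongrightarrow> c" by (auto simp: convergent_def)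
    have "(\<lambda>n. f (r n) j) \<longlonglongrightarrow> 0" if j: "j \<in> {1..m}" for j
    proof (rule tendsto_sandwich[OF _ _ tendsto_const])
      have "(\<lambda>n. K * (norm (W (r n) j *v x - L *v x))\<^sup>2) \<longlonglongrightarrow> K * (norm (L *v x - L *v x))\<^sup>2"
        by (intro tendsto_intros tendsto_matrix_vector_mult sub j)
      then show "(\<lambda>n. K * (norm ((W (r n) j - L) *v x))\<^sup>2) \<longlonglongrightarrow> 0"
        by (simp add: matrix_vector_mult_diff_rdistrib)
      show "\<forall>\<^sub>F n in sequentially. f (r n) j \<le> K * (norm ((W (r n) j - L) *v x))\<^sup>2"
        unfolding f_def using K(3)[OF j] by simp
    qed (auto simp: f_nonneg[OF j])
    then have "(\<lambda>n. \<Sum>j\<in>{1..m}. f (r n) j) \<longlonglongrightarrow> (\<Sum>j\<in>{1..m}. 0)"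
      by (intro tendsto_sum)
    moreover have "(\<lambda>n. \<Sum>j\<in>{1..m}. f (r n) j) \<longlonglongrightarrow> c"
      by (rule filterlim_compose[OF c r])
    ultimately have "c = 0" using LIMSEQ_unique by fastforce
    have "(\<lambda>t. (norm ((W t j - L) *v x))\<^sup>2) \<longlonglongrightarrow> 0"
    proof (rule tendsto_sandwich[OF _ _ tendsto_const])
      show "(\<lambda>t. K * (\<Sum>j\<in>{1..m}. f t j)) \<longlonglongrightarrow> 0"
        using tendsto_mult_left[OF c, of K] \<open>c = 0\<close> by simp
      show "\<forall>\<^sub>F t in sequentially. (norm ((W t j - L) *v x))\<^sup>2 \<le> K * (\<Sum>j\<in>{1..m}. f t j)"
      proof (intro always_eventually allI)
        fix t
        have pd: "matrix_inv (W t j) \<in> posdef_matrices" using j by (intro posdef_matrix_inv W_posdef)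
        have "matrix_inv (matrix_inv (W t j)) = W t j"
          using posdef_invertible[OF W_posdef[OF j]] by (intro matrix_inv_eqI matrix_inv_mult)
        then have "(norm ((W t j - L) *v x))\<^sup>2 \<le> K * f t j"
          unfolding f_def using K(2)[OF j] by (intro norm_le_of_inverse_bound[OF pd]) simp
        also have "\<dots> \<le> K * (\<Sum>j\<in>{1..m}. f t j)"
          using K(1) j f_nonneg by (intro mult_left_mono member_le_sum) auto
        finally show "(norm ((W t j - L) *v x))\<^sup>2 \<le> K * (\<Sum>j\<in>{1..m}. f t j)" .
      qed
    qed auto
    then have "(\<lambda>t. norm ((W t j - L) *v x)) \<longlonglongrightarrow> 0"
      using tendsto_real_sqrt by fastforce
    then have "(\<lambda>t. W t j *v x - L *v x) \<longlonglongrightarrow> 0"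
      by (simp add: tendsto_norm_zero_iff matrix_vector_mult_diff_rdistrib)
    then show "(\<lambda>t. W t j *v x) \<longlonglongrightarrow> L *v x" by (simp add: LIM_zero_iff)
  qed

  \<comment> \<open>The bound on the inverses keeps the limit away from the boundary of the cone.\<close>
  have "0 < x \<bullet> (L *v x)" if "x \<noteq> 0" for x
  proof -
    have "(\<lambda>t. K * (x \<bullet> (W t 1 *v x))) \<longlonglongrightarrow> K * (x \<bullet> (L *v x))"
      by (intro tendsto_intros tendsto_matrix_vector_mult full m)
    moreover have "(norm x)\<^sup>2 \<le> K * (x \<bullet> (W t 1 *v x))" for t
      using K(3)[OF m(2)] W_posdef[OF m(2)] by (intro norm_le_of_inverse_bound)
    ultimately have "(norm x)\<^sup>2 \<le> K * (x \<bullet> (L *v x))" by (intro LIMSEQ_le_const) auto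
    moreover have "0 < (norm x)\<^sup>2" using that by simp
    ultimately have "0 < K * (x \<bullet> (L *v x))" by linarith
    then show ?thesis using K(1) by (simp add: zero_less_mult_iff)
  qed
  then have "L \<in> posdef_matrices" using L_sym by (simp add: posdef_matrices_def)
  with full show ?thesis by blast
qed

lemma converges_if_dissipation_summable:
  assumes div: "filterlim (\<lambda>T. \<Sum>t<T. \<gamma> t) at_top sequentially"
    and summ: "\<And>i. i \<in> {1..m-1} \<Longrightarrow> summable (\<lambda>t. \<gamma> t * (norm (W t i - W t (i + 1)))\<^sup>2)"
  shows "\<exists>L \<in> posdef_matrices. \<forall>j\<in>{1..m}. (\<lambda>t. W t j) \<longlonglongrightarrow> L"
proof -
  define D where "D t = (\<Sum>i\<in>{1..m-1}. (norm (W t i - W t (i + 1)))\<^sup>2)" for t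
  have "summable (\<lambda>t. \<Sum>i\<in>{1..m-1}. \<gamma> t * (norm (W t i - W t (i + 1)))\<^sup>2)"
    by (intro summable_sum summ)
  then have "summable (\<lambda>t. \<gamma> t * D t)" by (simp add: D_def sum_distrib_left)
  moreover have "0 \<le> D t" for t unfolding D_def by (intro sum_nonneg) auto
  ultimately obtain r where r: "filterlim r at_top sequentially" "(\<lambda>n. D (r n)) \<longlonglongrightarrow> 0"
    using frequently_small_of_summable_weights[OF step_pos _ div] by blast
  have "(\<lambda>n. W (r n) i - W (r n) (i + 1)) \<longlonglongrightarrow> 0" if i: "i \<in> {1..m-1}" for i
  proof -
    have "(norm (W t i - W t (i + 1)))\<^sup>2 \<le> D t" for t
      unfolding D_def by (rule member_le_sum[OF i]) auto
    then have "(\<lambda>n. (norm (W (r n) i - W (r n) (i + 1)))\<^sup>2) \<longlonglongrightarrow> 0"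
      by (intro tendsto_sandwich[OF _ _ tendsto_const r(2)]) auto
    from tendsto_real_sqrt[OF this] show ?thesis by (simp add: tendsto_norm_zero_iff)
  qed
  with r(1) show ?thesis by (rule converges_if_neighbours_asymptotically_equal)
qed

end

text \<open>This is what makes the state at time \<open>t\<close> independent of the node picked at time \<open>t\<close>.\<close>

lemma gossip_past:
  assumes "\<And>u. u < t \<Longrightarrow> s u = s' u"
  shows "gossip \<gamma> s W0 t = gossip \<gamma> s' W0 t"
  using assms by (induction t) auto

theorem proposition7:
  fixes M :: "'w measure"
    and m :: nat
    and p :: "nat \<Rightarrow> real"
    and I :: "nat \<Rightarrow> 'w \<Rightarrow> nat"
    and \<gamma> :: "nat \<Rightarrow> real"
    and W0 :: "nat \<Rightarrow> real^'n^'n"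
  assumes "prob_space M"
    and "\<And>i. i \<in> {1..m-1} \<Longrightarrow> p i > 0"
    and "(\<Sum>i\<in>{1..m-1}. p i) = 1"
    and "prob_space.indep_vars M (\<lambda>_. count_space {1..m-1}) I UNIV"
    and "\<And>t i. i \<in> {1..m-1} \<Longrightarrow> measure M {\<omega> \<in> space M. I t \<omega> = i} = p i"
    and "\<And>j. j \<in> {1..m} \<Longrightarrow> W0 j \<in> posdef_matrices"
    and "\<And>t. \<gamma> t > 0"
    and "\<And>t. \<gamma> t \<le> 1/2"
    and "summable (\<lambda>t. (\<gamma> t)\<^sup>2)"
    and "filterlim (\<lambda>T. \<Sum>t<T. \<gamma> t) at_top sequentially"
  shows "AE \<omega> in M. \<exists>L \<in> posdef_matrices. \<forall>j\<in>{1..m}.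
           (\<lambda>t. gossip \<gamma> (\<lambda>t. I t \<omega>) W0 t j) \<longlonglongrightarrow> L"
proof -
  interpret prob_space M by (rule assms(1))
  have meas: "I t \<in> measurable M (count_space {1..m-1})" for t
    using assms(4) by (simp add: indep_vars_def)
  have run: "gossip_run m \<gamma> s W0" if "\<And>t. s t \<in> {1..m-1}" for s
    using that assms(6-8) by unfold_locales
  let ?F = "\<lambda>i t s. \<gamma> t * (norm (gossip \<gamma> s W0 t i - gossip \<gamma> s W0 t (i + 1)))\<^sup>2"
  obtain C where C: "\<And>s T. gossip_run m \<gamma> s W0 \<Longrightarrow> (\<Sum>t<T. ?F (s t) t s) \<le> C"
    using gossip_dissipation_bounded[of m \<gamma> W0] by blast
  have "AE \<omega> in M. summable (\<lambda>t. ?F i t (\<lambda>u. I u \<omega>))" if i: "i \<in> {1..m-1}" for i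
  proof (rule AE_summable_of_sampled_bound[OF _ assms(4) assms(2)[OF i] assms(5)[OF i]])
    fix s :: "nat \<Rightarrow> nat" and T assume "\<And>t. s t \<in> {1..m-1}"
    then have "(\<Sum>t<T. ?F (s t) t s) \<le> C" by (intro C run)
    moreover have "(\<Sum>t<T. ?F i t s * of_bool (s t = i)) \<le> (\<Sum>t<T. ?F (s t) t s)"
      using less_imp_le[OF assms(7)] by (intro sum_mono) auto
    ultimately show "(\<Sum>t<T. ?F i t s * of_bool (s t = i)) \<le> C" by linarith
  next
    fix t and s s' :: "nat \<Rightarrow> nat" assume "\<And>u. u < t \<Longrightarrow> s u = s' u"
    then have "gossip \<gamma> s W0 t = gossip \<gamma> s' W0 t" by (rule gossip_past)
    then show "?F i t s = ?F i t s'" by simp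
  qed (use less_imp_le[OF assms(7)] in auto)
  then have "AE \<omega> in M. \<forall>i\<in>{1..m-1}. summable (\<lambda>t. ?F i t (\<lambda>u. I u \<omega>))"
    by (intro AE_finite_allI) auto
  then show ?thesis
  proof (rule AE_mp, intro AE_I2 impI)
    fix \<omega> assume \<omega>: "\<omega> \<in> space M" and summ: "\<forall>i\<in>{1..m-1}. summable (\<lambda>t. ?F i t (\<lambda>u. I u \<omega>))"
    interpret gossip_run m \<gamma> "\<lambda>t. I t \<omega>" W0
      using measurable_space[OF meas \<omega>] by (intro run) simp
    show "\<exists>L \<in> posdef_matrices. \<forall>j\<in>{1..m}. (\<lambda>t. gossip \<gamma> (\<lambda>t. I t \<omega>) W0 t j) \<longlonglongrightarrow> L"
      using summ by (intro converges_if_dissipation_summable assms(10)) auto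
  qed
qed

end
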